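(* Let $K_t$, $t\in[a,b]$, be a non-degenerate shadow system in $\mathbb{R}^d$. Then $t\mapsto |K_t^*|^{-1}$ is a convex function of $t\in[a,b]$.
   Context: A convex body in $\mathbb{R}^d$ is a compact convex set with non-empty interior, and $|\cdot|$ denotes volume. For a convex body $K$ and an interior point $z$ of $K$, the polar body of $K$ with respect to $z$ is $K^{*z}=\{y\in\mathbb{R}^d : \langle y,x-z\rangle\le 1 \text{ for all } x\in K\}$. There is a unique point $S(K)\in\operatorname{int}K$, the Santaló point of $K$, such that $|K^{*S(K)}|=\min_{z\in\operatorname{int}K}|K^{*z}|$; write $K^*=K^{*S(K)}$. A shadow system along a direction $\theta\in\mathbb{S}^{d-1}$ is a family of sets $K_t=\operatorname{conv}\{x+\alpha(x)t\theta : x\in M\}$, where $M\subset\mathbb{R}^d$ is a bounded set, $\alpha:M\to\mathbb{R}$ is a bounded function, $t$ ranges over an interval of $\mathbb{R}$, and $\operatorname{conv}$ denotes the closed convex hull. It is non-degenerate if $K_t$ has non-empty interior for every $t$ in the interval. *)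

theory Defs
  imports "HOL-Analysis.Analysis"
begin

definition polar_body :: "(real ^ 'n) set \<Rightarrow> real ^ 'n \<Rightarrow> (real ^ 'n) set" where
  "polar_body K z = {y. \<forall>x\<in>K. y \<bullet> (x - z) \<le> 1}"

(* Meaningful only for convex bodies K (compact, convex, with nonempty interior), for which the
   minimiser exists and is unique; for other K the description operator may return an
   unspecified point. *)
definition santalo_point :: "(real ^ 'n) set \<Rightarrow> real ^ 'n" where
  "santalo_point K =
     (THE s. s \<in> interior K \<and>
        (\<forall>z\<in>interior K. measure lebesgue (polar_body K s) \<le> measure lebesgue (polar_body K z)))"

definition santalo_polar :: "(real ^ 'n) set \<Rightarrow> (real ^ 'n) set" where
  "santalo_polar K = polar_body K (santalo_point K)"

(* The values of \<alpha> outside M are irrelevant; in particular \<alpha> need only be bounded on M.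
   No continuity or measurability of \<alpha>, and no closedness of M, is required. *)
definition shadow_system ::
    "real set \<Rightarrow> real ^ 'n \<Rightarrow> (real \<Rightarrow> (real ^ 'n) set) \<Rightarrow> bool" where
  "shadow_system I \<theta> K \<longleftrightarrow>
     is_interval I \<and> \<theta> \<in> sphere 0 1 \<and>
     (\<exists>(M :: (real ^ 'n) set) (\<alpha> :: real ^ 'n \<Rightarrow> real).
        bounded M \<and> bounded (\<alpha> ` M) \<and>
        (\<forall>t\<in>I. K t = closure (convex hull ((\<lambda>x. x + (\<alpha> x * t) *\<^sub>R \<theta>) ` M))))"

definition nondegenerate_shadow_system ::
    "real set \<Rightarrow> real ^ 'n \<Rightarrow> (real \<Rightarrow> (real ^ 'n) set) \<Rightarrow> bool" where
  "nondegenerate_shadow_system I \<theta> K \<longleftrightarrow>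
     shadow_system I \<theta> K \<and> (\<forall>t\<in>I. interior (K t) \<noteq> {})"

end

theory Submission
  imports Defs "HOL-Probability.Distributions"
begin

text \<open>
  By homogeneity of the support function $h_K$, the volume of $K^{*z}$ is, up to the factor $d!$,
  the integral $F_K(z) = \int \exp(\langle y, z\rangle - h_K(y))\,dy$. It is strictly convex and lower
  semicontinuous in $z$, finite in the interior of $K$ and infinite outside, so the Santalo point exists.

  Split $F$ into the integrals $F^{\pm}$ over the half spaces $\pm\langle y,\theta\rangle > 0$. In the
  coordinates $y = s w$ with $\langle w,\theta\rangle = 1$ the half integral is a multiple of
  $\int h(w)^{-d}\,dw$ over a space of dimension $d - 1$. For a shadow system $h_{K_t}(w)$ is jointly
  convex in $(w, t)$, so by the Borell-Brascamp-Lieb inequality with exponent $-1/d$ (obtained from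
  dimension one by induction) the reciprocals of $F^+$ and $F^-$ are convex in $t$, provided the base
  point moves affinely along $\theta$.

  For the Santalo point $z$ of $K_t$, put $z_i = z + c (t_i - t)\theta$. As $c$ runs through the interval on
  which both $z_i$ are interior, blow-up at the ends and the intermediate value theorem give a $c$
  with $F^+_0 / F^+_1 = F^-_0 / F^-_1$. For this $c$ the two harmonic mean inequalities add up to
  $1/F_t(z) \le (1-l)/F_0(z_0) + l/F_1(z_1)$, and the right-hand side only increases when
  $z_0$, $z_1$ are replaced by the Santalo points.
\<close>

section \<open>Weighted power means and one-dimensional Brunn-Minkowski\<close>

text \<open>The splitting is forced. A generator
  \<open>x + (\<alpha> x * t) *\<^sub>R \<theta>\<close> pairs with y to give the bilinear term
  \<open>\<alpha> x * t * (y \<bullet> \<theta>)\<close>, so the support function is jointly convex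
  in (y, t) only while \<open>y \<bullet> \<theta>\<close> is held fixed. On the slice where it
  equals 1 (or -1) this term is affine in t, and a base point moving affinely along \<theta> merely
  adds another affine term; this leaves one free parameter c. Exponents: \<open>hmean k\<close> is
  the power mean with exponent -1/k. A convex h makes h^(-d) satisfy the mean inequality of index d,
  each integrated coordinate lowers the index by one, and after the d - 1 coordinates of the slice
  index 1, the harmonic mean, remains. Obstacle: harmonic means are superadditive, H(A0,A1) +
  H(B0,B1) <= H(A0+B0,A1+B1), the wrong direction for adding the bounds of the two half spaces.
  Equality holds exactly for proportional pairs; this is why c is tuned to equate the two
  ratios.\<close>

definition hmean :: "nat \<Rightarrow> real \<Rightarrow> real \<Rightarrow> real \<Rightarrow> real" where
  "hmean k l a b = ((1 - l) * a powr (- 1 / real k) + l * b powr (- 1 / real k)) powr (- real k)"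

lemma hmean_pos: "0 < l \<Longrightarrow> l < 1 \<Longrightarrow> 0 < a \<Longrightarrow> 0 < b \<Longrightarrow> 0 < hmean k l a b"
  unfolding hmean_def
  by (metis add_pos_pos diff_gt_0_iff_gt mult_pos_pos powr_gt_zero less_irrefl)

lemma hmean_scale:
  assumes "0 < k" "0 < l" "l < 1" "0 < a" "0 < b" "0 < s"
  shows "hmean k l (a * s) (b * s) = s * hmean k l a b"
proof -
  have "(1 - l) * (a * s) powr (- 1 / real k) + l * (b * s) powr (- 1 / real k)
    = s powr (- 1 / real k) * ((1 - l) * a powr (- 1 / real k) + l * b powr (- 1 / real k))"
    using assms by (simp add: powr_mult algebra_simps)
  then show ?thesis
    using assms unfolding hmean_def by (simp add: powr_mult powr_powr)
qed

lemma hmean_one: "0 < a \<Longrightarrow> 0 < b \<Longrightarrow> 0 < l \<Longrightarrow> l < 1 \<Longrightarrow> hmean 1 l a b = 1 / ((1 - l) / a + l / b)"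
  unfolding hmean_def by (simp add: powr_minus_divide add_pos_pos)

text \<open>The perspective \<open>x * (y / x) powr q = y powr q * x powr (- 1 / n)\<close> of the
  convex power q = (n+1)/n is jointly convex; apply it to (u, \<alpha>) and (v, \<beta>), then raise
  to the power -n. Later a, b are suprema of two truncated functions and A, B reals below the
  integrals.\<close>

lemma hmean_holder:
  assumes k: "0 < k" and l: "0 < l" "l < 1" and p: "0 < a" "0 < b" "0 < A" "0 < B"
  shows "hmean k l A B \<le> hmean (Suc k) l a b * ((1 - l) * A / a + l * B / b)"
proof -
  define n where "n = real k"
  have n: "0 < n" using k by (simp add: n_def)
  define \<alpha> where "\<alpha> = a powr (- 1 / (n + 1))"
  define \<beta> where "\<beta> = b powr (- 1 / (n + 1))"
  define u where "u = A / a"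
  define v where "v = B / b"
  define U where "U = (1 - l) * u + l * v"
  define S where "S = (1 - l) * \<alpha> + l * \<beta>"
  define q where "q = (n + 1) / n"
  have pos: "0 < \<alpha>" "0 < \<beta>" "0 < u" "0 < v" "0 < U" "0 < S"
    using p l by (auto simp: \<alpha>_def \<beta>_def u_def v_def U_def S_def intro!: add_pos_pos)
  have q: "1 \<le> q" "q * n = n + 1" using n by (auto simp: q_def)
  \<comment> \<open>Jensen weights proportional to (1 - l) u and l v, so that the combination of
    \<open>\<alpha> / u\<close> and \<open>\<beta> / v\<close> collapses to S / U.\<close>
  define w where "w = l * v / U"
  have w: "0 \<le> w" "w \<le> 1" "1 - w = (1 - l) * u / U"
    using pos l by (auto simp: w_def U_def field_simps)
  have "((1 - w) *\<^sub>R (\<alpha> / u) + w *\<^sub>R (\<beta> / v)) powr q \<le> (1 - w) * (\<alpha> / u) powr q + w * (\<beta> / v) powr q"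
    using pos w by (intro convex_onD[OF powr_convex[OF q(1)]]) auto
  moreover have "(1 - w) *\<^sub>R (\<alpha> / u) + w *\<^sub>R (\<beta> / v) = S / U"
    unfolding w(3) unfolding w_def S_def using pos by (simp add: field_simps)
  ultimately have "(S / U) powr q \<le> ((1 - l) * u * (\<alpha> / u) powr q + l * v * (\<beta> / v) powr q) / U"
    unfolding w(3) unfolding w_def by (simp add: add_divide_distrib)
  then have "U * (S / U) powr q \<le> (1 - l) * (u * (\<alpha> / u) powr q) + l * (v * (\<beta> / v) powr q)"
    using pos by (simp add: field_simps)
  moreover have persp: "x * (y / x) powr q = y powr q * x powr (- 1 / n)" if "0 < x" "0 < y" for x y :: real
  proof -
    have "(y / x) powr q = y powr q / x powr q" using that by (simp add: powr_divide)
    moreover have "x powr q = x * x powr (1 / n)"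
      using that n by (simp add: q_def add_divide_distrib powr_add)
    ultimately show ?thesis using that by (simp add: powr_minus_divide)
  qed
  moreover have "\<alpha> powr q * u powr (- 1 / n) = A powr (- 1 / n)"
  proof -
    have "A = a * u" using p by (simp add: u_def)
    moreover have "\<alpha> powr q = a powr (- 1 / n)"
      unfolding \<alpha>_def powr_powr q_def using n by (simp add: field_simps)
    ultimately show ?thesis using p pos by (simp add: powr_mult)
  qed
  moreover have "\<beta> powr q * v powr (- 1 / n) = B powr (- 1 / n)"
  proof -
    have "B = b * v" using p by (simp add: v_def)
    moreover have "\<beta> powr q = b powr (- 1 / n)"
      unfolding \<beta>_def powr_powr q_def using n by (simp add: field_simps)
    ultimately show ?thesis using p pos by (simp add: powr_mult)
  qed
  ultimately have main: "S powr q * U powr (- 1 / n) \<le> (1 - l) * A powr (- 1 / n) + l * B powr (- 1 / n)"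
    using pos by (simp add: persp)
  have "hmean k l A B \<le> (S powr q * U powr (- 1 / n)) powr (- n)"
    unfolding hmean_def n_def[symmetric] using main pos n by (intro powr_mono2') auto
  also have "\<dots> = S powr (- (n + 1)) * U"
    using pos n q by (simp add: powr_mult powr_powr)
  also have "\<dots> = hmean (Suc k) l a b * ((1 - l) * A / a + l * B / b)"
    unfolding hmean_def S_def U_def \<alpha>_def \<beta>_def u_def v_def n_def by (simp add: add.commute)
  finally show ?thesis .
qed

text \<open>Testing only positive reals strictly below \<open>F\<close> and \<open>G\<close> makes the relation meaningful for the
  values \<open>0\<close> (where it is vacuous) and \<open>\<infinity>\<close>.\<close>

definition mean_le :: "nat \<Rightarrow> real \<Rightarrow> ennreal \<Rightarrow> ennreal \<Rightarrow> ennreal \<Rightarrow> bool" where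
  "mean_le k l F G H \<longleftrightarrow>
    (\<forall>a b. 0 < a \<longrightarrow> 0 < b \<longrightarrow> ennreal a < F \<longrightarrow> ennreal b < G \<longrightarrow> ennreal (hmean k l a b) \<le> H)"

lemma mean_leD:
  "mean_le k l F G H \<Longrightarrow> 0 < a \<Longrightarrow> 0 < b \<Longrightarrow> ennreal a < F \<Longrightarrow> ennreal b < G \<Longrightarrow> ennreal (hmean k l a b) \<le> H"
  unfolding mean_le_def by blast

text \<open>\<open>inner_regular\<close> wants a finite measure, hence the cut to [-n, n]. The
  alternative c = 0 covers nonempty null sets: the compact set must be nonempty because its maximum
  or minimum is used next.\<close>

lemma compact_inner_approx:
  fixes A :: "real set"
  assumes A: "A \<in> sets borel" "A \<noteq> {}" and c: "c < emeasure lborel A \<or> c = 0"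
  obtains K where "compact K" "K \<noteq> {}" "K \<subseteq> A" "c \<le> emeasure lborel K"
proof (cases "c = 0")
  case True
  obtain x where "x \<in> A" using A by auto
  then show ?thesis by (intro that[of "{x}"]) (auto simp: True)
next
  case False
  then have c: "c < emeasure lborel A" using c by auto
  have "(SUP n::nat. emeasure lborel (A \<inter> {- real n..real n})) = emeasure lborel (\<Union>n::nat. A \<inter> {- real n..real n})"
    using A by (intro SUP_emeasure_incseq) (auto simp: incseq_def)
  moreover have "(\<Union>n::nat. A \<inter> {- real n..real n}) = A"
  proof -
    have "\<exists>n::nat. x \<in> {- real n..real n}" for x :: real
      using real_arch_simple[of "\<bar>x\<bar>"] by (auto simp: abs_le_iff minus_le_iff)
    then show ?thesis by auto
  qed
  ultimately have "c < (SUP n::nat. emeasure lborel (A \<inter> {- real n..real n}))"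
    using c by (simp only:)
  then obtain n where n: "c < emeasure lborel (A \<inter> {- real n..real n})"
    unfolding less_SUP_iff by blast
  define B where "B = A \<inter> {- real n..real n}"
  have B[measurable]: "B \<in> sets borel" using A by (auto simp: B_def)
  define M where "M = density lborel (indicator {- real n..real n} :: real \<Rightarrow> ennreal)"
  have M: "emeasure M X = emeasure lborel (X \<inter> {- real n..real n})" if "X \<in> sets borel" for X
    using that by (simp add: M_def emeasure_restricted Int_commute)
  have "emeasure M B = (SUP K \<in> {K. K \<subseteq> B \<and> compact K}. emeasure M K)"
    by (rule inner_regular) (auto simp: M_def emeasure_restricted)
  moreover have "c < emeasure M B" using n M[OF B] by (simp add: B_def Int_assoc)
  ultimately have "c < (SUP K \<in> {K. K \<subseteq> B \<and> compact K}. emeasure M K)"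
    by (simp only:)
  then obtain K where K: "K \<subseteq> B" "compact K" "c < emeasure M K"
    unfolding less_SUP_iff by blast
  moreover have "emeasure M K = emeasure lborel K"
    using K by (subst M) (auto simp: B_def compact_imp_closed intro!: arg_cong[where f="emeasure lborel"])
  moreover have "K \<noteq> {}" using K by auto
  ultimately show ?thesis by (intro that[of K]) (auto simp: B_def)
qed

lemma emeasure_lborel_affine_image:
  fixes K :: "real set"
  assumes "c \<noteq> 0" "K \<in> sets borel" "(\<lambda>x. t + c * x) ` K \<in> sets borel"
  shows "emeasure lborel ((\<lambda>x. t + c * x) ` K) = ennreal \<bar>c\<bar> * emeasure lborel K"
proof -
  have "emeasure lborel ((\<lambda>x. t + c * x) ` K) = (\<integral>\<^sup>+x. indicator ((\<lambda>x. t + c * x) ` K) x \<partial>lborel)"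
    using assms by simp
  also have "\<dots> = \<bar>c\<bar> * (\<integral>\<^sup>+x. indicator ((\<lambda>x. t + c * x) ` K) (t + c * x) \<partial>lborel)"
    using assms by (intro nn_integral_real_affine) auto
  also have "(\<lambda>x. indicator ((\<lambda>x. t + c * x) ` K) (t + c * x) :: ennreal) = indicator K"
    using assms by (auto simp: indicator_def fun_eq_iff)
  finally show ?thesis using assms by simp
qed

text \<open>Shifted scaled copies can be made to meet in at most one point: (1 - l) A + l min B lies
  to the left of (1 - l) max A + l B. Both are contained in C, and the measure of their union is the
  sum.\<close>

lemma brunn_minkowski_compact_1d:
  fixes A B C :: "real set"
  assumes l: "0 < l" "l < 1" and C: "C \<in> sets borel"
    and A: "compact A" "A \<noteq> {}" and B: "compact B" "B \<noteq> {}"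
    and sub: "\<And>x y. x \<in> A \<Longrightarrow> y \<in> B \<Longrightarrow> (1 - l) * x + l * y \<in> C"
  shows "ennreal (1 - l) * emeasure lborel A + ennreal l * emeasure lborel B \<le> emeasure lborel C"
proof -
  obtain s where s: "s \<in> A" "\<And>x. x \<in> A \<Longrightarrow> x \<le> s" using compact_attains_sup[OF A] by auto
  obtain i where i: "i \<in> B" "\<And>x. x \<in> B \<Longrightarrow> i \<le> x" using compact_attains_inf[OF B] by auto
  define A' where "A' = (\<lambda>x. l * i + (1 - l) * x) ` A"
  define B' where "B' = (\<lambda>x. (1 - l) * s + l * x) ` B"
  have [measurable]: "A' \<in> sets borel" "B' \<in> sets borel"
    unfolding A'_def B'_def using A B
    by (auto intro!: borel_compact compact_continuous_image continuous_intros)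
  have "A' \<inter> B' \<subseteq> {(1 - l) * s + l * i}"
  proof
    fix z assume "z \<in> A' \<inter> B'"
    then obtain x y where "x \<in> A" "y \<in> B" "z = l * i + (1 - l) * x" "z = (1 - l) * s + l * y"
      by (auto simp: A'_def B'_def)
    moreover have "(1 - l) * x \<le> (1 - l) * s" "l * i \<le> l * y"
      using s(2)[OF \<open>x \<in> A\<close>] i(2)[OF \<open>y \<in> B\<close>] l by (auto intro!: mult_left_mono)
    ultimately have "z = (1 - l) * s + l * i" by linarith
    then show "z \<in> {(1 - l) * s + l * i}" by simp
  qed
  then have "emeasure lborel (A' \<inter> B') \<le> emeasure lborel {(1 - l) * s + l * i}"
    by (intro emeasure_mono) auto
  then have null: "A' \<inter> B' \<in> null_sets lborel" by (auto intro!: null_setsI)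
  have "ennreal (1 - l) * emeasure lborel A + ennreal l * emeasure lborel B
      = emeasure lborel A' + emeasure lborel B'"
    unfolding A'_def B'_def using A B l
    by (subst (1 2) emeasure_lborel_affine_image)
       (auto simp: borel_compact intro!: borel_compact compact_continuous_image continuous_intros)
  also have "\<dots> = emeasure lborel (A' \<union> B')"
    using null by (intro emeasure_Un'[symmetric]) auto
  also have "\<dots> \<le> emeasure lborel C"
    using s(1) i(1) sub C by (intro emeasure_mono) (auto simp: A'_def B'_def add.commute)
  finally show ?thesis .
qed

lemma brunn_minkowski_1d:
  fixes A B C :: "real set"
  assumes l: "0 < l" "l < 1" and C: "C \<in> sets borel"
    and A: "A \<in> sets borel" "A \<noteq> {}" and B: "B \<in> sets borel" "B \<noteq> {}"
    and sub: "\<And>x y. x \<in> A \<Longrightarrow> y \<in> B \<Longrightarrow> (1 - l) * x + l * y \<in> C"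
  shows "ennreal (1 - l) * emeasure lborel A + ennreal l * emeasure lborel B \<le> emeasure lborel C"
proof -
  \<comment> \<open>Adding 0 keeps \<open>S x\<close> nonempty for x = 0, as the supremum rules for
    sums require; the case c = 0 of \<open>compact_inner_approx\<close> matches it.\<close>
  define S where "S x = {c. c < x \<or> c = (0::ennreal)}" for x
  have sup: "(SUP c\<in>S x. c) = x" for x
  proof (rule antisym)
    show "(SUP c\<in>S x. c) \<le> x"
    proof (rule SUP_least)
      fix c assume "c \<in> S x"
      then have "c < x \<or> c = 0" by (simp add: S_def)
      then show "c \<le> x" by (elim disjE) simp_all
    qed
    show "x \<le> (SUP c\<in>S x. c)"
    proof (rule dense_le)
      fix c assume "c < x"
      then have "c \<in> S x" by (simp add: S_def)
      then show "c \<le> (SUP c\<in>S x. c)" by (rule SUP_upper)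
    qed
  qed
  have ne: "S x \<noteq> {}" for x unfolding S_def by blast
  have *: "ennreal (1 - l) * c + ennreal l * c' \<le> emeasure lborel C"
    if c: "c \<in> S (emeasure lborel A)" "c' \<in> S (emeasure lborel B)" for c c'
  proof -
    obtain A' where A': "compact A'" "A' \<noteq> {}" "A' \<subseteq> A" "c \<le> emeasure lborel A'"
      using c(1) compact_inner_approx[OF A, of c] unfolding S_def mem_Collect_eq by metis
    obtain B' where B': "compact B'" "B' \<noteq> {}" "B' \<subseteq> B" "c' \<le> emeasure lborel B'"
      using c(2) compact_inner_approx[OF B, of c'] unfolding S_def mem_Collect_eq by metis
    have "ennreal (1 - l) * c + ennreal l * c' \<le> ennreal (1 - l) * emeasure lborel A' + ennreal l * emeasure lborel B'"
      using A' B' by (intro add_mono mult_left_mono) auto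
    also have "\<dots> \<le> emeasure lborel C"
      using l C A' B' sub by (intro brunn_minkowski_compact_1d) auto
    finally show ?thesis .
  qed
  have **: "ennreal (1 - l) * c + ennreal l * emeasure lborel B \<le> emeasure lborel C"
    if c: "c \<in> S (emeasure lborel A)" for c
  proof -
    have "ennreal l * emeasure lborel B = (SUP c'\<in>S (emeasure lborel B). ennreal l * c')"
      using SUP_mult_left_ennreal[of "ennreal l" "\<lambda>c. c" "S (emeasure lborel B)"] by (simp only: sup)
    then show ?thesis
      unfolding \<open>ennreal l * emeasure lborel B = _\<close> ennreal_SUP_add_right[OF ne]
      by (intro SUP_least * c)
  qed
  have "ennreal (1 - l) * emeasure lborel A = (SUP c\<in>S (emeasure lborel A). ennreal (1 - l) * c)"
    using SUP_mult_left_ennreal[of "ennreal (1 - l)" "\<lambda>c. c" "S (emeasure lborel A)"] by (simp only: sup)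
  then show ?thesis
    by (simp only: ennreal_SUP_add_left[OF ne, symmetric]) (intro SUP_least **)
qed

section \<open>Layer-cake formula with relative levels\<close>

lemma nn_integral_level:
  fixes v :: ennreal
  assumes a: "0 < a"
  shows "ennreal a * (\<integral>\<^sup>+s. indicator {s. 0 < s \<and> s < 1 \<and> ennreal (a * s) < v} s \<partial>lborel) = min v (ennreal a)"
    (is "?L = _")
    and "ennreal a * (\<integral>\<^sup>+s. indicator {s. 0 < s \<and> s < 1 \<and> ennreal (a * s) \<le> v} s \<partial>lborel) \<le> v" (is "?R \<le> _")
proof -
  have "?L = min v (ennreal a) \<and> ?R \<le> v"
  proof (cases v)
    case (real r)
    have 1: "{s. 0 < s \<and> s < 1 \<and> ennreal (a * s) < v} = {0<..<min (r / a) 1}"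
      using a real by (auto simp: ennreal_less_iff field_simps)
    have 2: "{s. 0 < s \<and> s < 1 \<and> ennreal (a * s) \<le> v} \<subseteq> {0..r / a}"
      using a real by (auto simp: field_simps)
    have "?L = ennreal a * emeasure lborel {0<..<min (r / a) 1}" unfolding 1 by simp
    also have "\<dots> = ennreal (min r a)" using a real
      by (simp add: ennreal_mult[symmetric] min_def field_simps)
    also have "\<dots> = min v a" using real a by (simp add: min_def)
    finally have L: "?L = min v a" .
    have "?R \<le> ennreal a * (\<integral>\<^sup>+s. indicator {0..r / a} s \<partial>lborel)"
      using 2 by (intro mult_left_mono nn_integral_mono) (auto split: split_indicator)
    also have "\<dots> = v" using a real by (simp add: ennreal_mult[symmetric])
    finally show ?thesis using L by simp
  next
    case top
    have "{s::real. 0 < s \<and> s < 1 \<and> ennreal (a * s) < v} = {0<..<1}" using top by auto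
    then show ?thesis using top by simp
  qed
  then show "?L = min v (ennreal a)" "?R \<le> v" by auto
qed

text \<open>Tonelli applied to \<open>nn_integral_level\<close>. Levels are written a * s with s in
  (0,1) so that functions with different suprema can be compared at the same relative height s. The
  strict version serves f and g, the weak one h, since \<open>mean_le\<close> yields only a weak
  lower bound for h.\<close>

lemma nn_integral_level_sets:
  assumes [measurable]: "f \<in> borel_measurable borel" and a: "0 < a"
  shows "(\<integral>\<^sup>+x. min (f x) (ennreal a) \<partial>lborel)
      = ennreal a * (\<integral>\<^sup>+s. emeasure lborel {x. ennreal (a * s) < f x} * indicator {0<..<1} s \<partial>lborel)" (is ?A)
    and "ennreal a * (\<integral>\<^sup>+s. emeasure lborel {x. ennreal (a * s) \<le> f x} * indicator {0<..<1} s \<partial>lborel)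
      \<le> (\<integral>\<^sup>+x. f x \<partial>lborel)" (is ?B)
proof -
  have "(\<integral>\<^sup>+x. min (f x) (ennreal a) \<partial>lborel)
    = ennreal a * (\<integral>\<^sup>+x. (\<integral>\<^sup>+s. indicator {s. 0 < s \<and> s < 1 \<and> ennreal (a * s) < f x} s \<partial>lborel) \<partial>lborel)"
    by (subst nn_integral_cmult[symmetric]) (auto simp: nn_integral_level(1)[OF a] simp del: nn_integral_indicator)
  also have "(\<integral>\<^sup>+x. (\<integral>\<^sup>+s. indicator {s. 0 < s \<and> s < 1 \<and> ennreal (a * s) < f x} s \<partial>lborel) \<partial>lborel)
    = (\<integral>\<^sup>+s. (\<integral>\<^sup>+x. indicator {s. 0 < s \<and> s < 1 \<and> ennreal (a * s) < f x} s \<partial>lborel) \<partial>lborel)"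
    by (rule lborel_pair.Fubini') simp
  also have "\<dots> = (\<integral>\<^sup>+s. (\<integral>\<^sup>+x. indicator {x. ennreal (a * s) < f x} x * indicator {0<..<1} s \<partial>lborel) \<partial>lborel)"
    by (intro nn_integral_cong) (auto split: split_indicator)
  also have "\<dots> = (\<integral>\<^sup>+s. emeasure lborel {x. ennreal (a * s) < f x} * indicator {0<..<1} s \<partial>lborel)"
    by (subst nn_integral_multc) simp_all
  finally show ?A .
  have "(\<integral>\<^sup>+s. emeasure lborel {x. ennreal (a * s) \<le> f x} * indicator {0<..<1} s \<partial>lborel)
    = (\<integral>\<^sup>+s. (\<integral>\<^sup>+x. indicator {x. ennreal (a * s) \<le> f x} x * indicator {0<..<1} s \<partial>lborel) \<partial>lborel)"
    by (subst nn_integral_multc) simp_all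
  also have "\<dots> = (\<integral>\<^sup>+s. (\<integral>\<^sup>+x. indicator {s. 0 < s \<and> s < 1 \<and> ennreal (a * s) \<le> f x} s \<partial>lborel) \<partial>lborel)"
    by (intro nn_integral_cong) (auto split: split_indicator)
  also have "\<dots> = (\<integral>\<^sup>+x. (\<integral>\<^sup>+s. indicator {s. 0 < s \<and> s < 1 \<and> ennreal (a * s) \<le> f x} s \<partial>lborel) \<partial>lborel)"
    by (rule lborel_pair.Fubini') simp
  finally have "ennreal a * (\<integral>\<^sup>+s. emeasure lborel {x. ennreal (a * s) \<le> f x} * indicator {0<..<1} s \<partial>lborel)
     = (\<integral>\<^sup>+x. ennreal a * (\<integral>\<^sup>+s. indicator {s. 0 < s \<and> s < 1 \<and> ennreal (a * s) \<le> f x} s \<partial>lborel) \<partial>lborel)"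
    by (subst nn_integral_cmult) simp_all
  also have "\<dots> \<le> (\<integral>\<^sup>+x. f x \<partial>lborel)"
    by (intro nn_integral_mono nn_integral_level(2)[OF a])
  finally show ?B .
qed

section \<open>The Borell-Brascamp-Lieb inequality\<close>

lemma nn_integral_less_truncate:
  fixes c :: ennreal
  assumes [measurable]: "f \<in> borel_measurable M" and c: "c < (\<integral>\<^sup>+x. f x \<partial>M)"
  obtains m :: nat where "c < (\<integral>\<^sup>+x. min (f x) (of_nat m) \<partial>M)"
proof -
  have sup: "(SUP m::nat. min v (of_nat m)) = v" for v :: ennreal
  proof (rule antisym)
    show "v \<le> (SUP m::nat. min v (of_nat m))"
    proof (rule dense_le)
      fix u assume u: "u < v"
      then have "u < top" by (rule order_less_le_trans) simp
      then obtain m :: nat where "u < of_nat m"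
        using ennreal_Ex_less_of_nat by blast
      then have "u \<le> min v (of_nat m)" using u by (simp add: less_imp_le)
      then show "u \<le> (SUP m::nat. min v (of_nat m))" by (rule SUP_upper2[OF UNIV_I])
    qed
  qed (simp add: SUP_le_iff)
  have "c < (\<integral>\<^sup>+x. (SUP m::nat. min (f x) (of_nat m)) \<partial>M)" using c by (simp only: sup)
  also have "\<dots> = (SUP m::nat. (\<integral>\<^sup>+x. min (f x) (of_nat m) \<partial>M))"
    by (intro nn_integral_monotone_convergence_SUP)
       (auto simp: incseq_def le_fun_def min_le_iff_disj)
  finally show ?thesis using that unfolding less_SUP_iff by blast
qed

text \<open>The strict inequality between A and the integral leaves room to truncate f at a finite
  m, so that the supremum a is a real number. For s < 1 the level set at height a * s is then
  nonempty, as Brunn-Minkowski demands.\<close>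

lemma bounded_level_representation:
  fixes f :: "real \<Rightarrow> ennreal"
  assumes [measurable]: "f \<in> borel_measurable borel" and A: "0 < A" "ennreal A < (\<integral>\<^sup>+x. f x \<partial>lborel)"
  obtains f' a where "f' \<in> borel_measurable borel" "\<And>x. f' x \<le> f x" "0 < a"
    "\<And>s. 0 < s \<Longrightarrow> s < 1 \<Longrightarrow> {x. ennreal (a * s) < f' x} \<noteq> {}"
    "ennreal (A / a) \<le> (\<integral>\<^sup>+s. emeasure lborel {x. ennreal (a * s) < f' x} * indicator {0<..<1} s \<partial>lborel)"
proof -
  obtain m :: nat where m: "ennreal A < (\<integral>\<^sup>+x. min (f x) (of_nat m) \<partial>lborel)"
    using nn_integral_less_truncate[of f lborel] A by auto
  define f' where "f' x = min (f x) (of_nat m)" for x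
  have [measurable]: "f' \<in> borel_measurable borel" unfolding f'_def by measurable
  define a where "a = enn2real (SUP x. f' x)"
  have "(SUP x. f' x) \<le> of_nat m" by (simp add: f'_def SUP_le_iff)
  then have fin: "(SUP x. f' x) < top" by (rule order_le_less_trans) (simp add: of_nat_less_top)
  then have a: "ennreal a = (SUP x. f' x)" by (simp add: a_def)
  have le: "f' x \<le> ennreal a" for x unfolding a by (rule SUP_upper) simp
  have "0 < a"
  proof (rule ccontr)
    assume "\<not> 0 < a"
    then have "f' x = 0" for x using le[of x] by (simp add: ennreal_neg)
    then have "(\<integral>\<^sup>+x. f' x \<partial>lborel) = 0" by simp
    then show False using m by (simp add: f'_def[symmetric])
  qed
  have ne: "{x. ennreal (a * s) < f' x} \<noteq> {}" if "0 < s" "s < 1" for s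
  proof -
    have "ennreal (a * s) < ennreal a" using that \<open>0 < a\<close> by (simp add: ennreal_less_iff)
    then show ?thesis unfolding a less_SUP_iff by blast
  qed
  have "ennreal A \<le> (\<integral>\<^sup>+x. f' x \<partial>lborel)" using m by (simp add: f'_def)
  also have "\<dots> = (\<integral>\<^sup>+x. min (f' x) (ennreal a) \<partial>lborel)"
    using le by (simp add: min_absorb1)
  also have "\<dots> = ennreal a * (\<integral>\<^sup>+s. emeasure lborel {x. ennreal (a * s) < f' x} * indicator {0<..<1} s \<partial>lborel)"
    (is "_ = _ * ?I") using \<open>0 < a\<close> by (intro nn_integral_level_sets) simp_all
  finally have "ennreal A \<le> ennreal a * ?I" .
  then have "ennreal (1 / a) * ennreal A \<le> ennreal (1 / a) * (ennreal a * ?I)"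
    by (rule mult_left_mono) simp
  then have "ennreal (A / a) \<le> ?I"
    using \<open>0 < a\<close> A by (simp add: ennreal_mult[symmetric] mult.assoc[symmetric])
  then show ?thesis using that[of f' a] ne \<open>0 < a\<close> by (auto simp: f'_def)
qed

text \<open>At relative height s the level sets of f' (at a s) and g' (at b s) average into the
  level set of h at M s, where M = \<open>hmean (Suc k) l a b\<close>. Brunn-Minkowski on the line,
  integrated over s, gives the bound M * ((1 - l) A / a + l B / b), and \<open>hmean_holder\<close>
  trades this for the mean of index k.\<close>

lemma mean_le_nn_integral_real:
  fixes f g h :: "real \<Rightarrow> ennreal"
  assumes k: "0 < k" and l: "0 < l" "l < 1"
    and [measurable]: "f \<in> borel_measurable borel" "g \<in> borel_measurable borel" "h \<in> borel_measurable borel"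
    and le: "\<And>x y. mean_le (Suc k) l (f x) (g y) (h ((1 - l) * x + l * y))"
  shows "mean_le k l (\<integral>\<^sup>+x. f x \<partial>lborel) (\<integral>\<^sup>+x. g x \<partial>lborel) (\<integral>\<^sup>+x. h x \<partial>lborel)"
  unfolding mean_le_def
proof (intro allI impI)
  fix A B :: real
  assume A: "0 < A" "ennreal A < (\<integral>\<^sup>+x. f x \<partial>lborel)" and B: "0 < B" "ennreal B < (\<integral>\<^sup>+x. g x \<partial>lborel)"
  obtain f' a where [measurable]: "f' \<in> borel_measurable borel" and f': "\<And>x. f' x \<le> f x" and a: "0 < a"
    and nef: "\<And>s. 0 < s \<Longrightarrow> s < 1 \<Longrightarrow> {x. ennreal (a * s) < f' x} \<noteq> {}"
    and If: "ennreal (A / a) \<le> (\<integral>\<^sup>+s. emeasure lborel {x. ennreal (a * s) < f' x} * indicator {0<..<1} s \<partial>lborel)"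
    using A by (rule bounded_level_representation[rotated]) auto
  obtain g' b where [measurable]: "g' \<in> borel_measurable borel" and g': "\<And>x. g' x \<le> g x" and b: "0 < b"
    and neg: "\<And>s. 0 < s \<Longrightarrow> s < 1 \<Longrightarrow> {x. ennreal (b * s) < g' x} \<noteq> {}"
    and Ig: "ennreal (B / b) \<le> (\<integral>\<^sup>+s. emeasure lborel {x. ennreal (b * s) < g' x} * indicator {0<..<1} s \<partial>lborel)"
    using B by (rule bounded_level_representation[rotated]) auto
  define M where "M = hmean (Suc k) l a b"
  have M: "0 < M" using hmean_pos a b l by (simp add: M_def)
  have bm: "ennreal (1 - l) * emeasure lborel {x. ennreal (a * s) < f' x}
      + ennreal l * emeasure lborel {x. ennreal (b * s) < g' x} \<le> emeasure lborel {x. ennreal (M * s) \<le> h x}"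
    if s: "0 < s" "s < 1" for s
  proof (rule brunn_minkowski_1d[OF l])
    fix x y assume "x \<in> {x. ennreal (a * s) < f' x}" "y \<in> {x. ennreal (b * s) < g' x}"
    then have "ennreal (a * s) < f x" "ennreal (b * s) < g y"
      using f'[of x] g'[of y] by auto
    then have "ennreal (hmean (Suc k) l (a * s) (b * s)) \<le> h ((1 - l) * x + l * y)"
      using a b s by (intro mean_leD[OF le]) auto
    then show "(1 - l) * x + l * y \<in> {x. ennreal (M * s) \<le> h x}"
      using l a b s by (simp add: hmean_scale M_def mult.commute)
  qed (use nef neg s in auto)
  have "hmean k l A B \<le> M * ((1 - l) * (A / a) + l * (B / b))"
    using hmean_holder[OF k l a b A(1) B(1)] by (simp add: M_def)
  then have "ennreal (hmean k l A B) \<le> ennreal (M * ((1 - l) * (A / a) + l * (B / b)))"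
    by (rule ennreal_leI)
  also have "\<dots> = ennreal M * (ennreal (1 - l) * ennreal (A / a) + ennreal l * ennreal (B / b))"
    using l a b A B M by (simp add: ennreal_mult[symmetric] ennreal_plus[symmetric] del: ennreal_plus)
  also have "\<dots> \<le> ennreal M *
      (ennreal (1 - l) * (\<integral>\<^sup>+s. emeasure lborel {x. ennreal (a * s) < f' x} * indicator {0<..<1} s \<partial>lborel)
      + ennreal l * (\<integral>\<^sup>+s. emeasure lborel {x. ennreal (b * s) < g' x} * indicator {0<..<1} s \<partial>lborel))"
    using If Ig by (intro mult_left_mono add_mono) auto
  also have "\<dots> = ennreal M * (\<integral>\<^sup>+s. (ennreal (1 - l) * emeasure lborel {x. ennreal (a * s) < f' x}
      + ennreal l * emeasure lborel {x. ennreal (b * s) < g' x}) * indicator {0<..<1} s \<partial>lborel)"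
    by (subst (1 2) nn_integral_cmult[symmetric], (measurable; fail), (measurable; fail))
       (subst nn_integral_add[symmetric], simp_all add: distrib_right mult.assoc)
  also have "\<dots> \<le> ennreal M * (\<integral>\<^sup>+s. emeasure lborel {x. ennreal (M * s) \<le> h x} * indicator {0<..<1} s \<partial>lborel)"
    using bm by (intro mult_left_mono nn_integral_mono) (auto split: split_indicator)
  also have "\<dots> \<le> (\<integral>\<^sup>+x. h x \<partial>lborel)"
    using M by (intro nn_integral_level_sets) simp_all
  finally show "ennreal (hmean k l A B) \<le> (\<integral>\<^sup>+x. h x \<partial>lborel)" .
qed

interpretation lborel_PiM: product_sigma_finite "\<lambda>_. lborel :: real measure" ..

text \<open>Induction on the coordinates: with those in I frozen,
  \<open>mean_le_nn_integral_real\<close> integrates out the new one and lowers the index by one, so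
  the inner integrals satisfy the hypothesis for I. The point z is given coordinatewise because
  points of the product space are \<open>undefined\<close> outside I.\<close>

lemma mean_le_nn_integral_PiM:
  fixes f g h :: "('i \<Rightarrow> real) \<Rightarrow> ennreal"
  assumes "finite I" and k: "0 < k" and l: "0 < l" "l < 1"
    and "f \<in> borel_measurable (\<Pi>\<^sub>M i\<in>I. lborel)" "g \<in> borel_measurable (\<Pi>\<^sub>M i\<in>I. lborel)"
      "h \<in> borel_measurable (\<Pi>\<^sub>M i\<in>I. lborel)"
    and "\<And>x y z. x \<in> extensional I \<Longrightarrow> y \<in> extensional I \<Longrightarrow> z \<in> extensional I \<Longrightarrow>
        (\<And>i. i \<in> I \<Longrightarrow> z i = (1 - l) * x i + l * y i) \<Longrightarrow> mean_le (k + card I) l (f x) (g y) (h z)"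
  shows "mean_le k l (integral\<^sup>N (\<Pi>\<^sub>M i\<in>I. lborel) f) (integral\<^sup>N (\<Pi>\<^sub>M i\<in>I. lborel) g)
    (integral\<^sup>N (\<Pi>\<^sub>M i\<in>I. lborel) h)"
  using assms(1,5-)
proof (induction I arbitrary: f g h rule: finite_induct)
  case empty
  show ?case
    using empty(4)[of "\<lambda>_. undefined" "\<lambda>_. undefined" "\<lambda>_. undefined"]
    by (simp add: lborel_PiM.nn_integral_empty)
next
  case (insert i I)
  note [measurable] = insert.prems(1-3)
  have meas[measurable]: "(\<lambda>x. \<integral>\<^sup>+s. u (x(i := s)) \<partial>lborel) \<in> borel_measurable (\<Pi>\<^sub>M i\<in>I. lborel)"
    "x \<in> extensional I \<Longrightarrow> (\<lambda>s. u (x(i := s))) \<in> borel_measurable borel"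
    if [measurable]: "u \<in> borel_measurable (\<Pi>\<^sub>M i\<in>insert i I. lborel)" for u :: "('i \<Rightarrow> real) \<Rightarrow> ennreal" and x
  proof -
    show "(\<lambda>x. \<integral>\<^sup>+s. u (x(i := s)) \<partial>lborel) \<in> borel_measurable (\<Pi>\<^sub>M i\<in>I. lborel)"
      by measurable
    show "(\<lambda>s. u (x(i := s))) \<in> borel_measurable borel" if "x \<in> extensional I"
      using measurable_comp[OF measurable_component_update[of x I "\<lambda>_. lborel" i] \<open>u \<in> _\<close>] that insert.hyps
      by (simp add: comp_def space_PiM PiE_def)
  qed
  show ?case
    unfolding lborel_PiM.product_nn_integral_insert[OF insert.hyps(1,2) insert.prems(1)]
      lborel_PiM.product_nn_integral_insert[OF insert.hyps(1,2) insert.prems(2)]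
      lborel_PiM.product_nn_integral_insert[OF insert.hyps(1,2) insert.prems(3)]
  proof (rule insert.IH)
    fix x y z :: "'i \<Rightarrow> real"
    assume xyz: "x \<in> extensional I" "y \<in> extensional I" "z \<in> extensional I"
      and z: "\<And>j. j \<in> I \<Longrightarrow> z j = (1 - l) * x j + l * y j"
    show "mean_le (k + card I) l (\<integral>\<^sup>+s. f (x(i := s)) \<partial>lborel) (\<integral>\<^sup>+s. g (y(i := s)) \<partial>lborel)
       (\<integral>\<^sup>+s. h (z(i := s)) \<partial>lborel)"
    proof (rule mean_le_nn_integral_real[OF _ l])
      fix s t
      have "mean_le (k + card (insert i I)) l (f (x(i := s))) (g (y(i := t))) (h (z(i := (1 - l) * s + l * t)))"
        using xyz z insert.hyps by (intro insert.prems(4)) (auto simp: extensional_def)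
      then show "mean_le (Suc (k + card I)) l (f (x(i := s))) (g (y(i := t))) (h (z(i := (1 - l) * s + l * t)))"
        using insert.hyps by simp
    qed (use k xyz meas(2) insert.prems in auto)
  qed (rule meas(1)[OF insert.prems(1)] meas(1)[OF insert.prems(2)] meas(1)[OF insert.prems(3)])+
qed

section \<open>Integrals over half spaces\<close>

text \<open>Substitution in one coordinate at a time. On the slice at height s in
  \<open>half_space_integral\<close> it produces the Jacobian s^(d-1).\<close>

lemma nn_integral_PiM_scale:
  fixes G :: "('i \<Rightarrow> real) \<Rightarrow> ennreal"
  assumes "finite I" and s: "0 < s" and "G \<in> borel_measurable (\<Pi>\<^sub>M i\<in>I. lborel)"
  shows "integral\<^sup>N (\<Pi>\<^sub>M i\<in>I. lborel) G
    = ennreal (s ^ card I) * (\<integral>\<^sup>+x. G (\<lambda>i\<in>I. s * x i) \<partial>(\<Pi>\<^sub>M i\<in>I. lborel))"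
  using assms(1,3)
proof (induction I arbitrary: G rule: finite_induct)
  case empty
  then show ?case
    by (subst (1 2) lborel_PiM.nn_integral_empty) (simp_all add: restrict_def)
next
  case (insert i I)
  note G[measurable] = insert.prems
  have G'[measurable]: "(\<lambda>x. \<integral>\<^sup>+r. G (x(i := s * r)) \<partial>lborel) \<in> borel_measurable (\<Pi>\<^sub>M i\<in>I. lborel)"
  proof -
    have "(\<lambda>(x, r). x(i := s * r)) = (\<lambda>(x, r). x(i := r)) \<circ> (\<lambda>(x, r). (x, s * r))" by (auto simp: fun_eq_iff)
    also have "\<dots> \<in> (\<Pi>\<^sub>M i\<in>I. lborel) \<Otimes>\<^sub>M lborel \<rightarrow>\<^sub>M (\<Pi>\<^sub>M i\<in>insert i I. lborel)"
      by (intro measurable_comp[OF _ measurable_add_dim]) measurable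
    finally have upd: "(\<lambda>(x, r). x(i := s * r)) \<in> (\<Pi>\<^sub>M i\<in>I. lborel) \<Otimes>\<^sub>M lborel \<rightarrow>\<^sub>M (\<Pi>\<^sub>M i\<in>insert i I. lborel)" .
    show ?thesis
      using measurable_comp[OF upd G] by (intro lborel.borel_measurable_nn_integral) (simp add: comp_def split_beta')
  qed
  have upd: "(\<lambda>j\<in>insert i I. s * (x(i := r)) j) = (\<lambda>j\<in>I. s * x j)(i := s * r)" for x r
    using insert.hyps by (auto simp: fun_eq_iff)
  have "integral\<^sup>N (\<Pi>\<^sub>M i\<in>insert i I. lborel) G = (\<integral>\<^sup>+x. (\<integral>\<^sup>+r. G (x(i := r)) \<partial>lborel) \<partial>(\<Pi>\<^sub>M i\<in>I. lborel))"
    using insert.hyps by (intro lborel_PiM.product_nn_integral_insert) simp_all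
  also have "\<dots> = (\<integral>\<^sup>+x. ennreal s * (\<integral>\<^sup>+r. G (x(i := s * r)) \<partial>lborel) \<partial>(\<Pi>\<^sub>M i\<in>I. lborel))"
  proof (rule nn_integral_cong)
    fix x assume "x \<in> space (\<Pi>\<^sub>M i\<in>I. lborel :: real measure)"
    then have "(\<lambda>r. G (x(i := r))) \<in> borel_measurable borel"
      using measurable_comp[OF measurable_component_update[of x I "\<lambda>_. lborel" i] G] insert.hyps
      by (simp add: comp_def)
    then show "(\<integral>\<^sup>+r. G (x(i := r)) \<partial>lborel) = ennreal s * (\<integral>\<^sup>+r. G (x(i := s * r)) \<partial>lborel)"
      using s by (subst nn_integral_real_affine[where t=0 and c=s]) auto
  qed
  also have "\<dots> = ennreal s * (ennreal (s ^ card I) *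
      (\<integral>\<^sup>+x. (\<integral>\<^sup>+r. G ((\<lambda>j\<in>I. s * x j)(i := s * r)) \<partial>lborel) \<partial>(\<Pi>\<^sub>M i\<in>I. lborel)))"
    by (subst nn_integral_cmult, rule G') (subst insert.IH[OF G'], rule refl)
  also have "(\<integral>\<^sup>+x. (\<integral>\<^sup>+r. G ((\<lambda>j\<in>I. s * x j)(i := s * r)) \<partial>lborel) \<partial>(\<Pi>\<^sub>M i\<in>I. lborel))
     = (\<integral>\<^sup>+x. G (\<lambda>j\<in>insert i I. s * x j) \<partial>(\<Pi>\<^sub>M i\<in>insert i I. lborel))"
    unfolding upd[symmetric] using insert.hyps
    by (intro lborel_PiM.product_nn_integral_insert[symmetric]) (simp_all, measurable)
  finally show ?case
    using insert.hyps s
    by (simp add: mult.assoc[symmetric] ennreal_mult[symmetric] restrict_def cong: if_cong)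
qed

lemma nn_integral_power_exp_scale:
  assumes q: "0 < q"
  shows "(\<integral>\<^sup>+s. ennreal (s ^ n * exp (- (s * q))) * indicator {0<..} s \<partial>lborel) = ennreal (fact n * (1 / q ^ Suc n))"
proof -
  have "(\<integral>\<^sup>+s. ennreal (s ^ n * exp (- (s * q))) * indicator {0<..} s \<partial>lborel)
     = (\<integral>\<^sup>+s. ennreal (s ^ n * exp (- (s * q))) * indicator {0..} s \<partial>lborel)"
    by (intro nn_integral_cong_AE) (use AE_lborel_singleton[of 0] in eventually_elim, auto split: split_indicator)
  also have "\<dots> = ennreal (1 / q) * (\<integral>\<^sup>+s. ennreal ((s / q) ^ n * exp (- s)) * indicator {0..} (s / q) \<partial>lborel)"
    using q by (subst nn_integral_real_affine[where t=0 and c="1/q"]) auto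
  also have "(\<integral>\<^sup>+s. ennreal ((s / q) ^ n * exp (- s)) * indicator {0..} (s / q) \<partial>lborel)
     = (\<integral>\<^sup>+s. ennreal ((1 / q) ^ n) * (ennreal (s ^ n * exp (- s)) * indicator {0..} s) \<partial>lborel)"
    using q by (intro nn_integral_cong)
      (auto split: split_indicator simp: ennreal_mult[symmetric] power_divide field_simps)
  also have "\<dots> = ennreal ((1 / q) ^ n) * ennreal (fact n)"
    by (subst nn_integral_cmult) (simp_all add: nn_intergal_power_times_exp_Ici)
  finally show ?thesis
    using q by (simp add: ennreal_mult[symmetric] power_divide field_simps)
qed

text \<open>In the coordinates $y = s\,w$ with $\langle w, \theta\rangle = 1$, the radial integral can be evaluated explicitly.\<close>

lemma half_space_integral:
  fixes \<theta> :: "'a :: euclidean_space"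
  assumes "\<theta> \<noteq> 0"
  obtains C :: real and I :: "'a set" and w :: "('a \<Rightarrow> real) \<Rightarrow> 'a" where
    "0 < C" "finite I" "DIM('a) = Suc (card I)" "\<And>x. w x \<bullet> \<theta> = 1"
    "\<And>x y z l. (\<And>i. i \<in> I \<Longrightarrow> z i = (1 - l) * x i + l * y i) \<Longrightarrow> w z = (1 - l) *\<^sub>R w x + l *\<^sub>R w y"
    "w \<in> (\<Pi>\<^sub>M i\<in>I. lborel) \<rightarrow>\<^sub>M borel"
    "\<And>p. p \<in> borel_measurable borel \<Longrightarrow> (\<And>s y. 0 < s \<Longrightarrow> p (s *\<^sub>R y) = s * p y) \<Longrightarrow>
      (\<And>y. 0 < y \<bullet> \<theta> \<Longrightarrow> 0 < p y) \<Longrightarrow>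
      (\<integral>\<^sup>+y. ennreal (exp (- p y)) * indicator {y. 0 < y \<bullet> \<theta>} y \<partial>lborel)
        = ennreal C * (\<integral>\<^sup>+x. ennreal (1 / p (w x) ^ DIM('a)) \<partial>(\<Pi>\<^sub>M i\<in>I. lborel))"
proof -
  \<comment> \<open>A coordinate k not orthogonal to \<theta> can be solved for; the other d - 1
    coordinates parametrise the hyperplanes on which \<open>y \<bullet> \<theta>\<close> is
    constant.\<close>
  obtain k where k: "k \<in> Basis" "\<theta> \<bullet> k \<noteq> 0"
    using assms by (metis euclidean_all_zero_iff)
  define I where "I = Basis - {k}"
  have I: "finite I" "k \<notin> I" "insert k I = Basis" "DIM('a) = Suc (card I)"
    using k by (auto simp: I_def card_Suc_Diff1)
  define v where "v = (1 / (\<theta> \<bullet> k)) *\<^sub>R k"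
  \<comment> \<open>\<open>L x\<close> is the point orthogonal to \<theta> whose coordinates other
    than k are x, so \<open>L x + s *\<^sub>R v\<close> lies at height s.\<close>
  define L where "L x = (\<Sum>j\<in>I. x j *\<^sub>R j) - (\<Sum>j\<in>I. x j * (j \<bullet> \<theta>)) *\<^sub>R v" for x :: "'a \<Rightarrow> real"
  have v: "v \<bullet> \<theta> = 1" using k by (simp add: v_def inner_commute)
  have L0: "L x \<bullet> \<theta> = 0" for x by (simp add: L_def inner_diff_left inner_sum_left v)
  have Lscale: "L (\<lambda>i\<in>I. s * x i) = s *\<^sub>R L x" for s x
    by (simp add: L_def scaleR_sum_right scaleR_diff_right sum_distrib_left mult.assoc cong: sum.cong)
  have [measurable]: "L \<in> (\<Pi>\<^sub>M i\<in>I. lborel) \<rightarrow>\<^sub>M borel" unfolding L_def by measurable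
  define n where "n = card I"
  \<comment> \<open>The Jacobian of replacing the coordinate k by the height s, times the Gamma
    integral (d-1)!.\<close>
  define C where "C = \<bar>1 / (\<theta> \<bullet> k)\<bar> * fact n"
  have main: "(\<integral>\<^sup>+y. ennreal (exp (- p y)) * indicator {y. 0 < y \<bullet> \<theta>} y \<partial>lborel)
        = ennreal C * (\<integral>\<^sup>+x. ennreal (1 / p (L x + v) ^ DIM('a)) \<partial>(\<Pi>\<^sub>M i\<in>I. lborel))"
    if [measurable]: "p \<in> borel_measurable borel" and hom: "\<And>s y. 0 < s \<Longrightarrow> p (s *\<^sub>R y) = s * p y"
      and pos: "\<And>y. 0 < y \<bullet> \<theta> \<Longrightarrow> 0 < p y" for p :: "'a \<Rightarrow> real"
  proof -
    define F where "F y = ennreal (exp (- p y)) * indicator {y. 0 < y \<bullet> \<theta>} y" for y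
    have F[measurable]: "F \<in> borel_measurable borel" unfolding F_def by measurable
    have "(\<integral>\<^sup>+y. F y \<partial>lborel) = (\<integral>\<^sup>+x. F (\<Sum>b\<in>Basis. x b *\<^sub>R b) \<partial>(\<Pi>\<^sub>M i\<in>insert k I. lborel))"
      unfolding I by (subst lborel_eq, subst nn_integral_distr) simp_all
    also have "\<dots> = (\<integral>\<^sup>+x. (\<integral>\<^sup>+r. F (\<Sum>b\<in>Basis. (x(k := r)) b *\<^sub>R b) \<partial>lborel) \<partial>(\<Pi>\<^sub>M i\<in>I. lborel))"
      using I by (intro lborel_PiM.product_nn_integral_insert) simp_all
    also have "\<dots> = (\<integral>\<^sup>+x. ennreal \<bar>1 / (\<theta> \<bullet> k)\<bar> * (\<integral>\<^sup>+s. F (L x + s *\<^sub>R v) \<partial>lborel) \<partial>(\<Pi>\<^sub>M i\<in>I. lborel))"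
    proof (rule nn_integral_cong)
      fix x
      define t where "t = - (\<Sum>j\<in>I. x j * (j \<bullet> \<theta>)) / (\<theta> \<bullet> k)"
      have "(\<Sum>b\<in>Basis. (x(k := r)) b *\<^sub>R b) = r *\<^sub>R k + (\<Sum>j\<in>I. x j *\<^sub>R j)" for r
      proof -
        have "(\<Sum>b\<in>Basis. (x(k := r)) b *\<^sub>R b) = (\<Sum>b\<in>insert k I. (x(k := r)) b *\<^sub>R b)" by (simp only: I)
        also have "\<dots> = r *\<^sub>R k + (\<Sum>j\<in>I. x j *\<^sub>R j)"
          using I by (subst sum.insert) (auto intro!: sum.cong)
        finally show ?thesis .
      qed
      then have "(\<integral>\<^sup>+r. F (\<Sum>b\<in>Basis. (x(k := r)) b *\<^sub>R b) \<partial>lborel)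
          = (\<integral>\<^sup>+r. F (r *\<^sub>R k + (\<Sum>j\<in>I. x j *\<^sub>R j)) \<partial>lborel)" by simp
      also have "\<dots> = ennreal \<bar>1 / (\<theta> \<bullet> k)\<bar> *
          (\<integral>\<^sup>+s. F ((t + 1 / (\<theta> \<bullet> k) * s) *\<^sub>R k + (\<Sum>j\<in>I. x j *\<^sub>R j)) \<partial>lborel)"
        using k by (intro nn_integral_real_affine) simp_all
      also have "(\<lambda>s. F ((t + 1 / (\<theta> \<bullet> k) * s) *\<^sub>R k + (\<Sum>j\<in>I. x j *\<^sub>R j))) = (\<lambda>s. F (L x + s *\<^sub>R v))"
        by (simp add: L_def v_def t_def algebra_simps)
      finally show "(\<integral>\<^sup>+r. F (\<Sum>b\<in>Basis. (x(k := r)) b *\<^sub>R b) \<partial>lborel)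
         = ennreal \<bar>1 / (\<theta> \<bullet> k)\<bar> * (\<integral>\<^sup>+s. F (L x + s *\<^sub>R v) \<partial>lborel)" .
    qed
    also have "\<dots> = ennreal \<bar>1 / (\<theta> \<bullet> k)\<bar> * (\<integral>\<^sup>+x. (\<integral>\<^sup>+s. F (L x + s *\<^sub>R v) \<partial>lborel) \<partial>(\<Pi>\<^sub>M i\<in>I. lborel))"
      by (intro nn_integral_cmult) measurable
    \<comment> \<open>The order is exchanged so that for each fixed s the scaling of x by s can be
      carried out, and exchanged back to integrate in s.\<close>
    also have "(\<integral>\<^sup>+x. (\<integral>\<^sup>+s. F (L x + s *\<^sub>R v) \<partial>lborel) \<partial>(\<Pi>\<^sub>M i\<in>I. lborel))
        = (\<integral>\<^sup>+s. (\<integral>\<^sup>+x. F (L x + s *\<^sub>R v) \<partial>(\<Pi>\<^sub>M i\<in>I. lborel)) \<partial>lborel)"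
      by (intro pair_sigma_finite.Fubini' pair_sigma_finite.intro lborel.sigma_finite_measure_axioms
          lborel_PiM.sigma_finite I) measurable
    also have "\<dots> = (\<integral>\<^sup>+s. (\<integral>\<^sup>+x. ennreal (s ^ n * exp (- (s * p (L x + v)))) * indicator {0<..} s \<partial>(\<Pi>\<^sub>M i\<in>I. lborel)) \<partial>lborel)"
    proof (rule nn_integral_cong)
      fix s :: real
      show "(\<integral>\<^sup>+x. F (L x + s *\<^sub>R v) \<partial>(\<Pi>\<^sub>M i\<in>I. lborel))
        = (\<integral>\<^sup>+x. ennreal (s ^ n * exp (- (s * p (L x + v)))) * indicator {0<..} s \<partial>(\<Pi>\<^sub>M i\<in>I. lborel))"
      proof (cases "0 < s")
        case True
        have "(\<integral>\<^sup>+x. F (L x + s *\<^sub>R v) \<partial>(\<Pi>\<^sub>M i\<in>I. lborel))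
          = ennreal (s ^ n) * (\<integral>\<^sup>+x. F (L (\<lambda>i\<in>I. s * x i) + s *\<^sub>R v) \<partial>(\<Pi>\<^sub>M i\<in>I. lborel))"
          unfolding n_def by (intro nn_integral_PiM_scale I True) measurable
        also have "(\<lambda>x. F (L (\<lambda>i\<in>I. s * x i) + s *\<^sub>R v)) = (\<lambda>x. ennreal (exp (- (s * p (L x + v)))))"
          using True by (simp add: F_def Lscale L0 v inner_add_left hom flip: scaleR_add_right)
        finally show ?thesis
          using True by (simp add: nn_integral_cmult[symmetric] ennreal_mult[symmetric])
      qed (simp add: F_def inner_add_left L0 v)
    qed
    also have "\<dots> = (\<integral>\<^sup>+x. (\<integral>\<^sup>+s. ennreal (s ^ n * exp (- (s * p (L x + v)))) * indicator {0<..} s \<partial>lborel) \<partial>(\<Pi>\<^sub>M i\<in>I. lborel))"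
      by (intro pair_sigma_finite.Fubini' pair_sigma_finite.intro lborel.sigma_finite_measure_axioms
          lborel_PiM.sigma_finite I) measurable
    also have "\<dots> = (\<integral>\<^sup>+x. ennreal (fact n) * ennreal (1 / p (L x + v) ^ DIM('a)) \<partial>(\<Pi>\<^sub>M i\<in>I. lborel))"
      unfolding I(4) n_def[symmetric]
      by (intro nn_integral_cong, subst nn_integral_power_exp_scale)
         (auto simp: ennreal_mult'[symmetric] inner_add_left L0 v intro!: pos)
    also have "\<dots> = ennreal (fact n) * (\<integral>\<^sup>+x. ennreal (1 / p (L x + v) ^ DIM('a)) \<partial>(\<Pi>\<^sub>M i\<in>I. lborel))"
      by (intro nn_integral_cmult) measurable
    moreover have "ennreal C = ennreal \<bar>1 / (\<theta> \<bullet> k)\<bar> * ennreal (fact n)"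
      unfolding C_def by (rule ennreal_mult) simp_all
    ultimately show ?thesis
      by (simp only: F_def mult.assoc)
  qed
  show ?thesis
  proof (rule that[of C I "\<lambda>x. L x + v"])
    show "0 < C" using k by (simp add: C_def)
    show "L z + v = (1 - l) *\<^sub>R (L x + v) + l *\<^sub>R (L y + v)"
      if "\<And>i. i \<in> I \<Longrightarrow> z i = (1 - l) * x i + l * y i" for x y z l
    proof -
      have z1: "(\<Sum>j\<in>I. z j *\<^sub>R j) = (1 - l) *\<^sub>R (\<Sum>j\<in>I. x j *\<^sub>R j) + l *\<^sub>R (\<Sum>j\<in>I. y j *\<^sub>R j)"
        using that unfolding scaleR_sum_right sum.distrib[symmetric]
        by (intro sum.cong refl) (simp only: scaleR_add_left scaleR_scaleR)
      have z2: "(\<Sum>j\<in>I. z j * (j \<bullet> \<theta>)) = (1 - l) * (\<Sum>j\<in>I. x j * (j \<bullet> \<theta>)) + l * (\<Sum>j\<in>I. y j * (j \<bullet> \<theta>))"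
        using that unfolding sum_distrib_left sum.distrib[symmetric]
        by (intro sum.cong refl) (simp only: distrib_right mult.assoc)
      show ?thesis unfolding L_def z1 z2 by (simp add: algebra_simps)
    qed
  qed (use I main in \<open>auto simp: inner_add_left L0 v\<close>)
qed

lemma mean_le_cmult:
  assumes "mean_le k l F G H" and l: "0 < l" "l < 1" "0 < k" and C: "0 < C"
  shows "mean_le k l (ennreal C * F) (ennreal C * G) (ennreal C * H)"
  unfolding mean_le_def
proof (intro allI impI)
  have *: "ennreal (a / C) < F" if "0 < a" "ennreal a < ennreal C * F" for a F
  proof (rule ccontr)
    assume "\<not> ennreal (a / C) < F"
    then have "ennreal C * F \<le> ennreal C * ennreal (a / C)" by (intro mult_left_mono) auto
    also have "\<dots> = ennreal a" using C that by (simp add: ennreal_mult[symmetric])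
    finally show False using that by simp
  qed
  fix a b :: real assume ab: "0 < a" "0 < b" "ennreal a < ennreal C * F" "ennreal b < ennreal C * G"
  have "ennreal (hmean k l a b) = ennreal C * ennreal (hmean k l (a / C) (b / C))"
    using hmean_scale[of k l "a / C" "b / C" C] hmean_pos[of l "a / C" "b / C" k] l C ab
    by (simp add: ennreal_mult[symmetric])
  also have "\<dots> \<le> ennreal C * H"
    using ab C * by (intro mult_left_mono mean_leD[OF assms(1)]) auto
  finally show "ennreal (hmean k l a b) \<le> ennreal C * H" .
qed

text \<open>The power -1/n takes 1/p^n back to p, so the mean inequality of index n reduces to the
  convexity estimate for p, q, r.\<close>

lemma mean_le_power:
  assumes l: "0 < l" "l < 1" "0 < n" and p: "0 < p" "0 < q" "0 < r" "r \<le> (1 - l) * p + l * q"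
  shows "mean_le n l (ennreal (1 / p ^ n)) (ennreal (1 / q ^ n)) (ennreal (1 / r ^ n))"
  unfolding mean_le_def
proof (intro allI impI)
  have *: "x \<le> a powr (- 1 / real n)" if "0 < a" "ennreal a < ennreal (1 / x ^ n)" "0 < x" for a x :: real
  proof -
    have "a < 1 / x ^ n" using that by (simp add: ennreal_less_iff)
    then have "(1 / x ^ n) powr (- 1 / real n) \<le> a powr (- 1 / real n)"
      using that l by (intro powr_mono2') auto
    moreover have "(1 / x ^ n) powr (- 1 / real n) = x"
    proof -
      have "1 / x ^ n = x powr (- real n)" using that by (simp add: powr_minus powr_realpow divide_inverse)
      then show ?thesis using that l by (simp add: powr_powr)
    qed
    ultimately show ?thesis by simp
  qed
  fix a b :: real
  assume ab: "0 < a" "0 < b" "ennreal a < ennreal (1 / p ^ n)" "ennreal b < ennreal (1 / q ^ n)"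
  have "r \<le> (1 - l) * a powr (- 1 / real n) + l * b powr (- 1 / real n)"
    using *[OF ab(1,3) p(1)] *[OF ab(2,4) p(2)] l p(4)
    by (smt (verit) mult_left_mono)
  then have "hmean n l a b \<le> r powr (- real n)"
    unfolding hmean_def using p by (intro powr_mono2') auto
  also have "\<dots> = 1 / r ^ n" using p by (simp add: powr_minus powr_realpow divide_inverse)
  finally show "ennreal (hmean n l a b) \<le> ennreal (1 / r ^ n)" by (rule ennreal_leI)
qed

text \<open>Convexity is asked for on the slice at height 1, which is all that
  \<open>half_space_integral\<close> sees. The integrands 1/p^d satisfy the mean inequality of index
  d = 1 + card I, and integrating over card I coordinates leaves index 1.\<close>

lemma mean_le_half_space:
  fixes \<theta> :: "'a :: euclidean_space" and p q r :: "'a \<Rightarrow> real"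
  assumes "\<theta> \<noteq> 0" and l: "0 < l" "l < 1"
    and [measurable]: "p \<in> borel_measurable borel" "q \<in> borel_measurable borel" "r \<in> borel_measurable borel"
    and hom: "\<And>s y. 0 < s \<Longrightarrow> p (s *\<^sub>R y) = s * p y" "\<And>s y. 0 < s \<Longrightarrow> q (s *\<^sub>R y) = s * q y"
      "\<And>s y. 0 < s \<Longrightarrow> r (s *\<^sub>R y) = s * r y"
    and pos: "\<And>y. 0 < y \<bullet> \<theta> \<Longrightarrow> 0 < p y" "\<And>y. 0 < y \<bullet> \<theta> \<Longrightarrow> 0 < q y" "\<And>y. 0 < y \<bullet> \<theta> \<Longrightarrow> 0 < r y"
    and le: "\<And>x y. x \<bullet> \<theta> = 1 \<Longrightarrow> y \<bullet> \<theta> = 1 \<Longrightarrow> r ((1 - l) *\<^sub>R x + l *\<^sub>R y) \<le> (1 - l) * p x + l * q y"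
  shows "mean_le 1 l (\<integral>\<^sup>+y. ennreal (exp (- p y)) * indicator {y. 0 < y \<bullet> \<theta>} y \<partial>lborel)
    (\<integral>\<^sup>+y. ennreal (exp (- q y)) * indicator {y. 0 < y \<bullet> \<theta>} y \<partial>lborel)
    (\<integral>\<^sup>+y. ennreal (exp (- r y)) * indicator {y. 0 < y \<bullet> \<theta>} y \<partial>lborel)"
proof -
  obtain C :: real and I :: "'a set" and w :: "('a \<Rightarrow> real) \<Rightarrow> 'a" where
    C: "0 < C" and I: "finite I" "DIM('a) = Suc (card I)" and w: "\<And>x. w x \<bullet> \<theta> = 1"
    "\<And>x y z l. (\<And>i. i \<in> I \<Longrightarrow> z i = (1 - l) * x i + l * y i) \<Longrightarrow> w z = (1 - l) *\<^sub>R w x + l *\<^sub>R w y"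
    and [measurable]: "w \<in> (\<Pi>\<^sub>M i\<in>I. lborel) \<rightarrow>\<^sub>M borel"
    and eq: "\<And>p. p \<in> borel_measurable borel \<Longrightarrow> (\<And>s y. 0 < s \<Longrightarrow> p (s *\<^sub>R y) = s * p y) \<Longrightarrow>
      (\<And>y. 0 < y \<bullet> \<theta> \<Longrightarrow> 0 < p y) \<Longrightarrow>
      (\<integral>\<^sup>+y. ennreal (exp (- p y)) * indicator {y. 0 < y \<bullet> \<theta>} y \<partial>lborel)
        = ennreal C * (\<integral>\<^sup>+x. ennreal (1 / p (w x) ^ DIM('a)) \<partial>(\<Pi>\<^sub>M i\<in>I. lborel))"
    by (rule half_space_integral[OF assms(1)]) blast
  have pw: "0 < p (w x)" "0 < q (w x)" "0 < r (w x)" for x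
    using pos w(1)[of x] by auto
  have "mean_le 1 l (\<integral>\<^sup>+x. ennreal (1 / p (w x) ^ DIM('a)) \<partial>(\<Pi>\<^sub>M i\<in>I. lborel))
    (\<integral>\<^sup>+x. ennreal (1 / q (w x) ^ DIM('a)) \<partial>(\<Pi>\<^sub>M i\<in>I. lborel))
    (\<integral>\<^sup>+x. ennreal (1 / r (w x) ^ DIM('a)) \<partial>(\<Pi>\<^sub>M i\<in>I. lborel))"
  proof (rule mean_le_nn_integral_PiM[OF I(1) _ l])
    fix x y z assume "\<And>i. i \<in> I \<Longrightarrow> z i = (1 - l) * x i + l * y i"
    then have "w z = (1 - l) *\<^sub>R w x + l *\<^sub>R w y" by (rule w(2))
    then have "r (w z) \<le> (1 - l) * p (w x) + l * q (w y)"
      using le w(1) by simp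
    then show "mean_le (1 + card I) l (ennreal (1 / p (w x) ^ DIM('a))) (ennreal (1 / q (w y) ^ DIM('a)))
      (ennreal (1 / r (w z) ^ DIM('a)))"
      unfolding I(2) plus_1_eq_Suc by (intro mean_le_power l pw) simp
  qed (simp, measurable)
  then show ?thesis
    using C by (simp only: eq hom pos assms) (intro mean_le_cmult l, auto)
qed

section \<open>Polar integrals of convex bodies\<close>

lemma nn_integral_exp_tail: "(\<integral>\<^sup>+s. ennreal (exp (- s)) * indicator {c..} s \<partial>lborel) = ennreal (exp (- c))"
proof -
  have "(\<integral>\<^sup>+s. ennreal (exp (- s)) * indicator {c..} s \<partial>lborel)
    = (\<integral>\<^sup>+s. ennreal (exp (- c)) * (ennreal (s ^ 0 * exp (- s)) * indicator {0..} s) \<partial>lborel)"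
    by (subst nn_integral_real_affine[where t=c and c=1])
       (auto intro!: nn_integral_cong split: split_indicator simp: ennreal_mult[symmetric] exp_add[symmetric])
  also have "\<dots> = ennreal (exp (- c))"
    by (subst nn_integral_cmult) (simp_all add: nn_intergal_power_times_exp_Ici del: power_0)
  finally show ?thesis .
qed

lemma emeasure_lborel_scale_preimage:
  fixes A :: "'a :: euclidean_space set"
  assumes "0 < s" and [measurable]: "A \<in> sets borel"
  shows "emeasure lborel A = ennreal (s ^ DIM('a)) * emeasure lborel {y. s *\<^sub>R y \<in> A}"
proof -
  have "emeasure lborel A = emeasure (density (distr lborel borel (\<lambda>x. 0 + s *\<^sub>R x)) (\<lambda>_. \<bar>s\<bar> ^ DIM('a))) A"
    using assms by (subst lborel_affine[of s 0]) auto
  also have "\<dots> = ennreal (s ^ DIM('a)) * emeasure lborel {y. s *\<^sub>R y \<in> A}"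
    using assms by (simp add: emeasure_density nn_integral_cmult emeasure_distr vimage_def)
  finally show ?thesis .
qed

text \<open>Write exp(-p y) as the integral of exp(-s) over s >= p y and exchange integrals: by
  homogeneity {p <= s} has volume s^d |{p <= 1}|, and the integral of s^d exp(-s) is d!.\<close>

lemma nn_integral_exp_homogeneous:
  fixes p :: "'a :: euclidean_space \<Rightarrow> real"
  assumes [measurable]: "p \<in> borel_measurable borel" and hom: "\<And>s y. 0 < s \<Longrightarrow> p (s *\<^sub>R y) = s * p y"
    and pos: "\<And>y. 0 \<le> p y"
  shows "(\<integral>\<^sup>+y. ennreal (exp (- p y)) \<partial>lborel) = ennreal (fact DIM('a)) * emeasure lborel {y. p y \<le> 1}"
proof -
  have "(\<integral>\<^sup>+y. ennreal (exp (- p y)) \<partial>lborel)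
      = (\<integral>\<^sup>+y. (\<integral>\<^sup>+s. ennreal (exp (- s)) * indicator {p y..} s \<partial>lborel) \<partial>lborel)"
    by (simp only: nn_integral_exp_tail)
  also have "\<dots> = (\<integral>\<^sup>+y. (\<integral>\<^sup>+s. ennreal (exp (- s)) * indicator {y. p y \<le> s} y \<partial>lborel) \<partial>lborel)"
    by (intro nn_integral_cong) (auto split: split_indicator)
  also have "\<dots> = (\<integral>\<^sup>+s. (\<integral>\<^sup>+y. ennreal (exp (- s)) * indicator {y. p y \<le> s} y \<partial>lborel) \<partial>lborel)"
    by (rule pair_sigma_finite.Fubini') (auto intro!: pair_sigma_finite.intro lborel.sigma_finite_measure_axioms)
  also have "\<dots> = (\<integral>\<^sup>+s. ennreal (exp (- s)) * emeasure lborel {y. p y \<le> s} \<partial>lborel)"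
    by (subst nn_integral_cmult) auto
  also have "\<dots> = (\<integral>\<^sup>+s. (ennreal (s ^ DIM('a) * exp (- s)) * indicator {0..} s) * emeasure lborel {y. p y \<le> 1} \<partial>lborel)"
  proof (intro nn_integral_cong_AE)
    show "AE s in lborel. ennreal (exp (- s)) * emeasure lborel {y. p y \<le> s}
        = (ennreal (s ^ DIM('a) * exp (- s)) * indicator {0..} s) * emeasure lborel {y. p y \<le> 1}"
      using AE_lborel_singleton[of "0::real"]
    proof eventually_elim
      case (elim s)
      show ?case
      proof (cases "0 < s")
        case True
        then have "emeasure lborel {y. p y \<le> s} = ennreal (s ^ DIM('a)) * emeasure lborel {y. p y \<le> 1}"
          by (subst emeasure_lborel_scale_preimage[OF True]) (auto simp: hom)
        then show ?thesis using True by (simp add: ennreal_mult mult_ac)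
      next
        case False
        then have "s < 0" using elim by simp
        then have "\<not> p y \<le> s" for y using pos[of y] by linarith
        then have "{y. p y \<le> s} = {}" by blast
        then show ?thesis using False elim by simp
      qed
    qed
  qed
  also have "\<dots> = ennreal (fact DIM('a)) * emeasure lborel {y. p y \<le> 1}"
    by (subst nn_integral_multc) (simp_all add: nn_intergal_power_times_exp_Ici)
  finally show ?thesis .
qed

lemma AE_inner_neq_0:
  fixes u :: "'a :: euclidean_space"
  assumes "u \<noteq> 0" shows "AE y in lborel. y \<bullet> u \<noteq> 0"
proof -
  have "{y. u \<bullet> y = 0} \<in> null_sets lborel"
    using negligible_hyperplane[of u 0] assms
    by (auto simp: negligible_iff_null_sets null_sets_completion_iff)
  then have "AE y in lborel. y \<notin> {y. u \<bullet> y = 0}" by (rule AE_not_in)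
  then show ?thesis by (simp add: inner_commute)
qed

text \<open>The support function of K - z; for z interior to a convex body it is the gauge of the
  polar body. For compact nonempty K it stays finite when z leaves K, so the integrals below make
  sense at every base point.\<close>

definition dual_gauge :: "'a :: euclidean_space set \<Rightarrow> 'a \<Rightarrow> 'a \<Rightarrow> real" where
  "dual_gauge K z y = (SUP x\<in>K. y \<bullet> (x - z))"

definition polar_integral :: "'a :: euclidean_space set \<Rightarrow> 'a \<Rightarrow> ennreal" where
  "polar_integral K z = (\<integral>\<^sup>+y. ennreal (exp (- dual_gauge K z y)) \<partial>lborel)"

definition half_polar_integral :: "'a \<Rightarrow> 'a :: euclidean_space set \<Rightarrow> 'a \<Rightarrow> ennreal" where
  "half_polar_integral \<theta> K z = (\<integral>\<^sup>+y. ennreal (exp (- dual_gauge K z y)) * indicator {y. 0 < y \<bullet> \<theta>} y \<partial>lborel)"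

locale convex_body =
  fixes K :: "'a :: euclidean_space set"
  assumes compact: "compact K" and convex: "convex K" and interior: "interior K \<noteq> {}"
begin

lemma nonempty: "K \<noteq> {}" using interior interior_subset by blast

lemma bdd: "bdd_above ((\<lambda>x. y \<bullet> (x - z)) ` K)"
  using compact by (intro bounded_imp_bdd_above compact_imp_bounded compact_continuous_image continuous_intros)

lemma dual_gauge_ge: "x \<in> K \<Longrightarrow> y \<bullet> (x - z) \<le> dual_gauge K z y"
  unfolding dual_gauge_def by (rule cSUP_upper[OF _ bdd])

lemma dual_gauge_le: "(\<And>x. x \<in> K \<Longrightarrow> y \<bullet> (x - z) \<le> c) \<Longrightarrow> dual_gauge K z y \<le> c"
  unfolding dual_gauge_def by (rule cSUP_least[OF nonempty])

lemma dual_gauge_scale: assumes "0 < s" shows "dual_gauge K z (s *\<^sub>R y) = s * dual_gauge K z y"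
proof (rule antisym)
  show "dual_gauge K z (s *\<^sub>R y) \<le> s * dual_gauge K z y"
    using assms by (intro dual_gauge_le) (simp add: dual_gauge_ge)
  have "dual_gauge K z y \<le> dual_gauge K z (s *\<^sub>R y) / s"
    using assms dual_gauge_ge[of _ "s *\<^sub>R y" z] by (intro dual_gauge_le) (simp add: field_simps)
  then show "s * dual_gauge K z y \<le> dual_gauge K z (s *\<^sub>R y)"
    using assms by (simp add: field_simps)
qed

lemma dual_gauge_add: "dual_gauge K z (x + y) \<le> dual_gauge K z x + dual_gauge K z y"
  by (intro dual_gauge_le) (simp add: inner_add_left add_mono dual_gauge_ge)

text \<open>The base point enters only through a term affine in z. Convexity, continuity and
  monotonicity of the integrals in z all come from this.\<close>

lemma dual_gauge_shift: "dual_gauge K z y = dual_gauge K w y + y \<bullet> (w - z)"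
proof (rule antisym)
  show "dual_gauge K z y \<le> dual_gauge K w y + y \<bullet> (w - z)"
    using dual_gauge_ge[of _ y w] by (intro dual_gauge_le) (fastforce simp: inner_diff_right)
  have "dual_gauge K w y \<le> dual_gauge K z y - y \<bullet> (w - z)"
    using dual_gauge_ge[of _ y z] by (intro dual_gauge_le) (fastforce simp: inner_diff_right)
  then show "dual_gauge K w y + y \<bullet> (w - z) \<le> dual_gauge K z y" by simp
qed

lemma continuous_dual_gauge: "continuous_on UNIV (dual_gauge K z)"
proof (rule convex_on_continuous[OF open_UNIV], rule convex_onI)
  fix t x y assume t: "0 < (t::real)" "t < 1"
  show "dual_gauge K z ((1 - t) *\<^sub>R x + t *\<^sub>R y) \<le> (1 - t) * dual_gauge K z x + t * dual_gauge K z y"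
    using dual_gauge_add[of z "(1 - t) *\<^sub>R x" "t *\<^sub>R y"] t by (simp add: dual_gauge_scale)
qed simp

lemma measurable_dual_gauge[measurable]: "dual_gauge K z \<in> borel_measurable borel"
  using continuous_dual_gauge by (rule borel_measurable_continuous_onI)

lemma dual_gauge_ge_norm:
  assumes "z \<in> interior K" obtains e where "0 < e" "\<And>y. e * norm y \<le> dual_gauge K z y"
proof -
  obtain e where e: "0 < e" "cball z e \<subseteq> K" using assms by (auto simp: mem_interior_cball)
  have "e * norm y \<le> dual_gauge K z y" for y
  proof (cases "y = 0")
    case True
    have "z \<in> K" using assms interior_subset by blast
    then show ?thesis using dual_gauge_ge[of z y z] True by simp
  next
    case False
    have "z + (e / norm y) *\<^sub>R y \<in> K" using e False by (intro subsetD[OF e(2)]) (simp add: dist_norm)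
    from dual_gauge_ge[OF this, of y z] show ?thesis
      using False by (simp add: dot_square_norm power2_eq_square)
  qed
  then show ?thesis using e that by blast
qed

lemma dual_gauge_pos:
  assumes "z \<in> interior K" "y \<noteq> 0" shows "0 < dual_gauge K z y"
proof -
  obtain e where e: "0 < e" "\<And>y. e * norm y \<le> dual_gauge K z y"
    using dual_gauge_ge_norm[OF assms(1)] by blast
  have "0 < e * norm y" using e(1) assms(2) by simp
  then show ?thesis using e(2)[of y] by linarith
qed

lemma dual_gauge_nonneg: "z \<in> interior K \<Longrightarrow> 0 \<le> dual_gauge K z y"
  using dual_gauge_ge[of z y z] interior_subset[of K] by auto

lemma polar_integral_eq:
  "z \<in> interior K \<Longrightarrow>
    polar_integral K z = ennreal (fact DIM('a)) * emeasure lborel {y. dual_gauge K z y \<le> 1}"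
  unfolding polar_integral_def
  by (rule nn_integral_exp_homogeneous) (auto simp: dual_gauge_scale dual_gauge_nonneg)

lemma polar_integral_finite:
  assumes "z \<in> interior K" shows "polar_integral K z < top"
proof -
  obtain e where e: "0 < e" "\<And>y. e * norm y \<le> dual_gauge K z y"
    using dual_gauge_ge_norm[OF assms] by blast
  have "{y. dual_gauge K z y \<le> 1} \<subseteq> cball 0 (1 / e)"
  proof
    fix y assume "y \<in> {y. dual_gauge K z y \<le> 1}"
    then have "e * norm y \<le> 1" using e(2)[of y] by simp
    then show "y \<in> cball 0 (1 / e)" using e(1) by (simp add: field_simps)
  qed
  then have "emeasure lborel {y. dual_gauge K z y \<le> 1} \<le> emeasure lborel (cball (0::'a) (1 / e))"
    by (intro emeasure_mono) auto
  also have "\<dots> < top" using emeasure_bounded_finite[of "cball (0::'a) (1/e)"] by (simp add: less_top)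
  finally show ?thesis using assms by (simp add: polar_integral_eq ennreal_mult_less_top)
qed

lemma positive_integral_open:
  assumes "open U" "U \<noteq> {}"
  shows "0 < (\<integral>\<^sup>+y. ennreal (exp (- dual_gauge K z y)) * indicator U y \<partial>lborel)"
proof (rule ccontr)
  have [measurable]: "U \<in> sets borel" using assms by auto
  assume "\<not> ?thesis"
  then have "AE y in lborel. ennreal (exp (- dual_gauge K z y)) * indicator U y = 0"
    by (subst (asm) not_gr_zero, subst (asm) nn_integral_0_iff_AE) auto
  then have "AE y in lborel. y \<notin> U" by eventually_elim (auto split: split_indicator_asm)
  then have "U \<in> null_sets lborel" using assms by (subst AE_iff_null_sets) auto
  then show False
    using assms open_not_negligible[of U] by (simp add: negligible_iff_null_sets null_sets_completionI)
qed

lemma half_polar_integral_pos: assumes "\<theta> \<noteq> 0" shows "0 < half_polar_integral \<theta> K z"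
proof -
  have "\<theta> \<in> {y. 0 < y \<bullet> \<theta>}" using assms by simp
  moreover have "open {y. 0 < y \<bullet> \<theta>}" by (intro open_Collect_less continuous_intros)
  ultimately show ?thesis unfolding half_polar_integral_def by (intro positive_integral_open) blast+
qed

lemma polar_integral_split:
  assumes "\<theta> \<noteq> 0"
  shows "polar_integral K z = half_polar_integral \<theta> K z + half_polar_integral (- \<theta>) K z"
proof -
  have "AE y in lborel. y \<bullet> \<theta> \<noteq> 0" using assms by (rule AE_inner_neq_0)
  then have "polar_integral K z = (\<integral>\<^sup>+y. ennreal (exp (- dual_gauge K z y)) * indicator {y. 0 < y \<bullet> \<theta>} y
      + ennreal (exp (- dual_gauge K z y)) * indicator {y. 0 < y \<bullet> (- \<theta>)} y \<partial>lborel)"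
    unfolding polar_integral_def
    by (intro nn_integral_cong_AE, eventually_elim) (auto split: split_indicator)
  also have "\<dots> = half_polar_integral \<theta> K z + half_polar_integral (- \<theta>) K z"
    unfolding half_polar_integral_def by (intro nn_integral_add) simp_all
  finally show ?thesis .
qed

lemma half_polar_integral_finite:
  assumes "z \<in> interior K" shows "half_polar_integral \<theta> K z < top"
proof -
  have "half_polar_integral \<theta> K z \<le> polar_integral K z"
    unfolding half_polar_integral_def polar_integral_def by (intro nn_integral_mono) (auto split: split_indicator)
  then show ?thesis using polar_integral_finite[OF assms] by (rule order_le_less_trans)
qed

text \<open>Translating by \<open>u\<close> does not decrease the integrand but strictly enlarges the half space.\<close>

lemma half_polar_integral_infinite:
  assumes u: "\<And>x. x \<in> K \<Longrightarrow> u \<bullet> x \<le> u \<bullet> z" and \<theta>: "0 < u \<bullet> \<theta>"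
  shows "half_polar_integral \<theta> K z = top"
proof (rule ccontr)
  let ?e = "\<lambda>y. ennreal (exp (- dual_gauge K z y))"
  \<comment> \<open>U is the strip gained by the half space under the translation. If the integral
    were finite, translation invariance would force the integral over U to vanish, although U is
    open and nonempty.\<close>
  define U where "U = {y. - (u \<bullet> \<theta>) < y \<bullet> \<theta> \<and> y \<bullet> \<theta> < 0}"
  have [measurable]: "U \<in> sets borel" unfolding U_def by measurable
  assume "half_polar_integral \<theta> K z \<noteq> top"
  have "dual_gauge K z u \<le> 0" using u by (intro dual_gauge_le) (simp add: inner_diff_right)
  then have mono: "?e y \<le> ?e (u + y)" for y
    using dual_gauge_add[of z u y] by (intro ennreal_leI) simp
  have "half_polar_integral \<theta> K z + (\<integral>\<^sup>+y. ?e y * indicator U y \<partial>lborel)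
      = (\<integral>\<^sup>+y. ?e y * indicator {y. 0 < y \<bullet> \<theta>} y + ?e y * indicator U y \<partial>lborel)"
    unfolding half_polar_integral_def by (intro nn_integral_add[symmetric]) simp_all
  also have "\<dots> \<le> (\<integral>\<^sup>+y. ?e (u + y) * indicator {y. 0 < y \<bullet> \<theta>} (u + y) \<partial>lborel)"
    using mono \<theta> by (intro nn_integral_mono) (auto split: split_indicator simp: U_def inner_add_left)
  also have "\<dots> = (\<integral>\<^sup>+y. ?e y * indicator {y. 0 < y \<bullet> \<theta>} y \<partial>distr lborel borel ((+) u))"
    by (subst nn_integral_distr) simp_all
  also have "\<dots> = half_polar_integral \<theta> K z"
    unfolding half_polar_integral_def lborel_distr_plus ..
  finally have "half_polar_integral \<theta> K z + (\<integral>\<^sup>+y. ?e y * indicator U y \<partial>lborel) \<le> half_polar_integral \<theta> K z + 0"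
    by simp
  then have "(\<integral>\<^sup>+y. ?e y * indicator U y \<partial>lborel) = 0"
    using \<open>half_polar_integral \<theta> K z \<noteq> top\<close> unfolding ennreal_add_left_cancel_le by simp
  moreover have "0 < (\<integral>\<^sup>+y. ?e y * indicator U y \<partial>lborel)"
  proof (rule positive_integral_open)
    show "open U" unfolding U_def by (intro open_Collect_conj open_Collect_less continuous_intros)
    have "(- (1 / 2)) *\<^sub>R u \<in> U" using \<theta> by (simp add: U_def)
    then show "U \<noteq> {}" by blast
  qed
  ultimately show False by simp
qed

text \<open>Separation of z from the interior, extended to K by density. The inequality is strict at
  interior points because a small step along u stays in K; on a chord this strictness fixes the sign
  of \<open>u \<bullet> \<theta>\<close>.\<close>

lemma supporting_functional:
  assumes "z \<notin> interior K"
  obtains u where "u \<noteq> 0" "\<And>x. x \<in> K \<Longrightarrow> u \<bullet> x \<le> u \<bullet> z" "\<And>x. x \<in> interior K \<Longrightarrow> u \<bullet> x < u \<bullet> z"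
proof -
  obtain u b where u: "u \<noteq> 0" "\<forall>x\<in>interior K. u \<bullet> x \<le> b" "\<forall>x\<in>{z}. b \<le> u \<bullet> x"
    using separating_hyperplane_sets[of "interior K" "{z}"] convex interior assms
    by (auto simp: convex_interior)
  have le: "u \<bullet> x \<le> u \<bullet> z" if "x \<in> K" for x
  proof -
    have "K \<subseteq> closure (interior K)"
      using convex_closure_interior[OF convex interior] closure_subset by auto
    also have "\<dots> \<subseteq> {x. u \<bullet> x \<le> b}"
      using u by (intro closure_minimal closed_halfspace_le) auto
    finally show ?thesis using that u(3) by auto
  qed
  moreover have "u \<bullet> x < u \<bullet> z" if x: "x \<in> interior K" for x
  proof -
    obtain e where e: "0 < e" "cball x e \<subseteq> K" using x by (auto simp: mem_interior_cball)
    have "x + (e / norm u) *\<^sub>R u \<in> K" using e u(1) by (intro subsetD[OF e(2)]) (simp add: dist_norm)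
    from le[OF this] have "u \<bullet> x + e * norm u \<le> u \<bullet> z"
      using u(1) by (simp add: inner_add_right dot_square_norm power2_eq_square)
    then show ?thesis using e(1) u(1) by (smt (verit) mult_pos_pos zero_less_norm_iff)
  qed
  ultimately show ?thesis using u(1) that by blast
qed

lemma polar_integral_infinite:
  assumes "z \<notin> interior K" shows "polar_integral K z = top"
proof -
  obtain u where "u \<noteq> 0" "\<And>x. x \<in> K \<Longrightarrow> u \<bullet> x \<le> u \<bullet> z"
    by (rule supporting_functional[OF assms]) (rule that, assumption+)
  \<comment> \<open>Splitting along the supporting direction u itself makes the half with
    \<open>0 < y \<bullet> u\<close> already infinite.\<close>
  then show ?thesis using polar_integral_split[of u z] half_polar_integral_infinite[of u z u] by simp
qed

end

section \<open>The Santalo point\<close>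

context convex_body
begin

text \<open>Fatou's lemma, the integrands converging pointwise by \<open>dual_gauge_shift\<close>.
  The whole space as U serves the existence of the minimiser, a half space the blow-up along
  chords.\<close>

lemma nn_integral_exp_lsc:
  assumes "w \<longlonglongrightarrow> z" and [measurable]: "U \<in> sets borel"
  shows "(\<integral>\<^sup>+y. ennreal (exp (- dual_gauge K z y)) * indicator U y \<partial>lborel)
    \<le> liminf (\<lambda>n. \<integral>\<^sup>+y. ennreal (exp (- dual_gauge K (w n) y)) * indicator U y \<partial>lborel)"
proof -
  obtain q where q: "q \<in> K" using nonempty by blast
  have "(\<lambda>n. ennreal (exp (- dual_gauge K (w n) y))) \<longlonglongrightarrow> ennreal (exp (- dual_gauge K z y))" for y
  proof (intro tendsto_ennrealI tendsto_exp tendsto_minus)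
    have "(\<lambda>n. dual_gauge K q y + y \<bullet> (q - w n)) \<longlonglongrightarrow> dual_gauge K q y + y \<bullet> (q - z)"
      by (intro tendsto_intros assms)
    then show "(\<lambda>n. dual_gauge K (w n) y) \<longlonglongrightarrow> dual_gauge K z y"
      by (simp only: dual_gauge_shift[of _ y q, symmetric])
  qed
  then have "liminf (\<lambda>n. ennreal (exp (- dual_gauge K (w n) y)) * indicator U y)
      = ennreal (exp (- dual_gauge K z y)) * indicator U y" for y
    by (intro lim_imp_Liminf) (auto split: split_indicator)
  then have "(\<integral>\<^sup>+y. ennreal (exp (- dual_gauge K z y)) * indicator U y \<partial>lborel)
      = (\<integral>\<^sup>+y. liminf (\<lambda>n. ennreal (exp (- dual_gauge K (w n) y)) * indicator U y) \<partial>lborel)"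
    by simp
  also have "\<dots> \<le> liminf (\<lambda>n. \<integral>\<^sup>+y. ennreal (exp (- dual_gauge K (w n) y)) * indicator U y \<partial>lborel)"
    by (rule nn_integral_liminf) simp
  finally show ?thesis .
qed

lemma polar_integral_lsc:
  "w \<longlonglongrightarrow> z \<Longrightarrow> polar_integral K z \<le> liminf (\<lambda>n. polar_integral K (w n))"
  using nn_integral_exp_lsc[of w z UNIV] by (simp add: polar_integral_def)

lemma half_polar_integral_lsc:
  "w \<longlonglongrightarrow> z \<Longrightarrow> half_polar_integral \<theta> K z \<le> liminf (\<lambda>n. half_polar_integral \<theta> K (w n))"
  unfolding half_polar_integral_def by (rule nn_integral_exp_lsc) simp_all

text \<open>Lower semicontinuity gives a minimiser over the compact K, boundary included. Its value
  is finite by comparison with an interior point, and off the interior the integral is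
  infinite.\<close>

lemma polar_integral_has_minimum:
  obtains s where "s \<in> interior K" "\<And>z. z \<in> interior K \<Longrightarrow> polar_integral K s \<le> polar_integral K z"
proof -
  define m where "m = (INF z\<in>K. polar_integral K z)"
  obtain w where w: "\<And>n. w n \<in> polar_integral K ` K" "w \<longlonglongrightarrow> m"
    unfolding m_def using Inf_as_limit[of "polar_integral K ` K"] nonempty by auto
  then have "\<forall>n. \<exists>z. z \<in> K \<and> w n = polar_integral K z" by blast
  then obtain z where z: "\<And>n. z n \<in> K" "\<And>n. w n = polar_integral K (z n)" by metis
  obtain s r where s: "s \<in> K" "strict_mono (r :: nat \<Rightarrow> nat)" "(z \<circ> r) \<longlonglongrightarrow> s"
    using compact z(1) unfolding compact_def by metis
  have "polar_integral K s \<le> liminf (\<lambda>n. polar_integral K ((z \<circ> r) n))"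
    using s(3) by (rule polar_integral_lsc)
  also have "\<dots> = m"
  proof (rule lim_imp_Liminf)
    have "(w \<circ> r) \<longlonglongrightarrow> m" using w(2) s(2) by (rule LIMSEQ_subseq_LIMSEQ)
    then show "(\<lambda>n. polar_integral K ((z \<circ> r) n)) \<longlonglongrightarrow> m" by (simp add: comp_def z(2))
  qed simp
  finally have le: "polar_integral K s \<le> m" .
  have m: "m \<le> polar_integral K x" if "x \<in> interior K" for x
    using that interior_subset unfolding m_def by (intro INF_lower) blast
  obtain x where x: "x \<in> interior K" using interior by blast
  have "polar_integral K s < top"
    using le m[OF x] polar_integral_finite[OF x] by (meson order_le_less_trans order_trans)
  then have "s \<in> interior K" using polar_integral_infinite[of s] by (metis less_irrefl)
  then show ?thesis using le m by (rule that[OF _ order_trans])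
qed

text \<open>Relative to the midpoint q, the gauges at s and t are shifted by -c y and +c y, so the
  two integrands average to the one at q times cosh (c y), which exceeds 1 off the null set
  \<open>y \<bullet> (s - t) = 0\<close>. Finiteness at q keeps the inequality strict after
  integration.\<close>

lemma polar_integral_midpoint_less:
  assumes s: "s \<in> interior K" "t \<in> interior K" "s \<noteq> t" and eq: "polar_integral K s = polar_integral K t"
  shows "polar_integral K (midpoint s t) < polar_integral K s"
proof -
  define q where "q = midpoint s t"
  define c where "c y = y \<bullet> (s - t) / 2" for y
  have ds: "dual_gauge K s y = dual_gauge K q y - c y" and dt: "dual_gauge K t y = dual_gauge K q y + c y" for y
    using dual_gauge_shift[of s y q] dual_gauge_shift[of t y q]
    by (auto simp: q_def c_def midpoint_def inner_diff_right inner_add_right inner_simps field_simps)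
  have q: "q \<in> interior K" unfolding q_def
    using s convex by (meson convex_interior convex_contains_segment midpoint_in_closed_segment subsetD)
  let ?e = "\<lambda>z y. exp (- dual_gauge K z y)"
  have cosh: "?e s y + ?e t y = ?e q y * (exp (c y) + exp (- c y))" for y
    by (simp add: ds dt exp_diff exp_minus exp_add field_simps)
  have two: "2 \<le> exp x + exp (- x)" "x \<noteq> 0 \<Longrightarrow> 2 < exp x + exp (- x)" for x :: real
  proof -
    have "exp x + exp (- x) - 2 = (exp (x / 2) - exp (- x / 2))\<^sup>2"
      by (simp add: power2_eq_square algebra_simps exp_add[symmetric])
    moreover have "x \<noteq> 0 \<Longrightarrow> 0 < (exp (x / 2) - exp (- x / 2))\<^sup>2"
      by simp
    ultimately show "2 \<le> exp x + exp (- x)" "x \<noteq> 0 \<Longrightarrow> 2 < exp x + exp (- x)"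
      using zero_le_power2[of "exp (x / 2) - exp (- x / 2)"] by linarith+
  qed
  have le: "?e q y \<le> (?e s y + ?e t y) / 2" for y
    using mult_left_mono[OF two(1)[of "c y"], of "?e q y"] cosh[of y] by simp
  have less: "?e q y < (?e s y + ?e t y) / 2" if "y \<bullet> (s - t) \<noteq> 0" for y
    using mult_strict_left_mono[OF two(2)[of "c y"], of "?e q y"] cosh[of y] that by (simp add: c_def)
  have half: "ennreal ((a + b) / 2) = ennreal (1 / 2) * (ennreal a + ennreal b)" if "0 \<le> a" "0 \<le> b" for a b
  proof -
    have "ennreal ((a + b) / 2) = ennreal (1 / 2 * (a + b))" by simp
    also have "\<dots> = ennreal (1 / 2) * ennreal (a + b)" using that by (intro ennreal_mult) simp_all
    finally show ?thesis using that by (simp only: ennreal_plus)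
  qed
  have "polar_integral K q < (\<integral>\<^sup>+y. ennreal ((?e s y + ?e t y) / 2) \<partial>lborel)"
    unfolding polar_integral_def
  proof (rule nn_integral_less)
    show "(\<integral>\<^sup>+y. ennreal (?e q y) \<partial>lborel) \<noteq> \<infinity>"
      using polar_integral_finite[OF q] by (simp add: polar_integral_def less_top)
    show "AE y in lborel. ennreal (?e q y) \<le> ennreal ((?e s y + ?e t y) / 2)"
      using le by (intro AE_I2 ennreal_leI)
    show "\<not> (AE y in lborel. ennreal ((?e s y + ?e t y) / 2) \<le> ennreal (?e q y))"
    proof
      assume "AE y in lborel. ennreal ((?e s y + ?e t y) / 2) \<le> ennreal (?e q y)"
      moreover have "AE y in lborel. y \<bullet> (s - t) \<noteq> 0" using s by (intro AE_inner_neq_0) simp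
      ultimately have "AE y in (lborel :: 'a measure). False"
      proof eventually_elim
        case (elim y)
        then have "(?e s y + ?e t y) / 2 \<le> ?e q y" by (subst (asm) ennreal_le_iff) simp_all
        then show ?case using less[OF elim(2)] by linarith
      qed
      then show False by (simp add: eventually_False ae_filter_eq_bot_iff)
    qed
  qed simp_all
  also have "\<dots> = (\<integral>\<^sup>+y. ennreal (1 / 2) * (ennreal (?e s y) + ennreal (?e t y)) \<partial>lborel)"
    by (simp only: half exp_ge_zero)
  also have "\<dots> = ennreal (1 / 2) * (polar_integral K s + polar_integral K t)"
    unfolding polar_integral_def by (simp add: nn_integral_cmult nn_integral_add)
  also have "\<dots> = polar_integral K s"
  proof -
    obtain r where "polar_integral K s = ennreal r" "0 \<le> r"
      using polar_integral_finite[OF s(1)] by (cases "polar_integral K s") auto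
    then show ?thesis using half[of r r] unfolding eq[symmetric] by simp
  qed
  finally show ?thesis by (simp add: q_def)
qed

end

lemma (in convex_body) measure_polar_eq:
  assumes "z \<in> interior K"
  shows "measure lebesgue {y. dual_gauge K z y \<le> 1} = enn2real (polar_integral K z) / fact DIM('a)"
proof -
  have "{y. dual_gauge K z y \<le> 1} \<in> sets borel" by simp
  then have "measure lebesgue {y. dual_gauge K z y \<le> 1} = enn2real (emeasure lborel {y. dual_gauge K z y \<le> 1})"
    by (simp add: measure_def)
  then show ?thesis by (simp add: polar_integral_eq[OF assms] enn2real_mult)
qed

lemma (in convex_body) polar_integral_le_iff:
  assumes "z \<in> interior K" "w \<in> interior K"
  shows "enn2real (polar_integral K z) \<le> enn2real (polar_integral K w) \<longleftrightarrow> polar_integral K z \<le> polar_integral K w"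
  using polar_integral_finite[OF assms(1)] polar_integral_finite[OF assms(2)]
  by (cases "polar_integral K z"; cases "polar_integral K w") auto

text \<open>On the interior, polar volume and \<open>polar_integral\<close> are finite and differ by
  the factor d!, so they have the same minimisers. Two distinct minimisers would be beaten by their
  midpoint; uniqueness makes \<open>THE\<close> denote the minimiser.\<close>

lemma santalo:
  fixes K :: "(real ^ 'n) set"
  assumes "convex_body K"
  shows "santalo_point K \<in> interior K"
    and "z \<in> interior K \<Longrightarrow> polar_integral K (santalo_point K) \<le> polar_integral K z"
    and "measure lebesgue (santalo_polar K) = enn2real (polar_integral K (santalo_point K)) / fact CARD('n)"
proof -
  interpret convex_body K by fact
  have polar: "polar_body K z = {y. dual_gauge K z y \<le> 1}" for z
    unfolding polar_body_def by (auto intro: dual_gauge_le order_trans[OF dual_gauge_ge])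
  have meas: "measure lebesgue (polar_body K z) = enn2real (polar_integral K z) / fact CARD('n)"
    if "z \<in> interior K" for z
    using measure_polar_eq[OF that] by (simp add: polar)
  define P where "P s \<longleftrightarrow> s \<in> interior K \<and>
    (\<forall>z\<in>interior K. measure lebesgue (polar_body K s) \<le> measure lebesgue (polar_body K z))" for s
  have P: "P s \<longleftrightarrow> s \<in> interior K \<and> (\<forall>z\<in>interior K. polar_integral K s \<le> polar_integral K z)" for s
    unfolding P_def by (auto simp: meas divide_le_cancel polar_integral_le_iff)
  obtain s where "P s" unfolding P using polar_integral_has_minimum by metis
  moreover have "t = s" if "P t" for t
  proof (rule ccontr)
    assume "t \<noteq> s"
    have "polar_integral K t = polar_integral K s"
      using that \<open>P s\<close> unfolding P by (blast intro: antisym)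
    then have "polar_integral K (midpoint t s) < polar_integral K t"
      using \<open>t \<noteq> s\<close> that \<open>P s\<close> unfolding P by (intro polar_integral_midpoint_less) auto
    moreover have "midpoint t s \<in> interior K"
      using that \<open>P s\<close> convex unfolding P
      by (meson convex_interior convex_contains_segment midpoint_in_closed_segment subsetD)
    ultimately show False using that unfolding P by (simp add: not_le[symmetric])
  qed
  ultimately have "P (THE s. P s)" by (rule theI)
  then have "P (santalo_point K)" unfolding santalo_point_def P_def .
  then show "santalo_point K \<in> interior K"
    and "z \<in> interior K \<Longrightarrow> polar_integral K (santalo_point K) \<le> polar_integral K z"
    and "measure lebesgue (santalo_polar K) = enn2real (polar_integral K (santalo_point K)) / fact CARD('n)"
    unfolding P santalo_polar_def using meas by auto
qed

section \<open>Balancing the two half spaces\<close>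

context convex_body
begin

text \<open>For fixed y the integrand is convex in z, the gauge being affine in z; a finite convex
  function on an open set is continuous.\<close>

lemma continuous_half_polar_integral:
  "continuous_on (interior K) (\<lambda>z. enn2real (half_polar_integral \<theta> K z))"
proof (rule convex_on_continuous[OF open_interior], rule convex_onI)
  fix s z w assume s: "0 < (s::real)" "s < 1" and z: "z \<in> interior K" "w \<in> interior K"
  define q where "q = (1 - s) *\<^sub>R z + s *\<^sub>R w"
  have q: "q \<in> interior K"
    using convexD[OF convex_interior[OF convex] z, of "1 - s" s] s by (simp add: q_def)
  let ?e = "\<lambda>z y. exp (- dual_gauge K z y)"
  have le: "?e q y \<le> (1 - s) * ?e z y + s * ?e w y" for y
  proof -
    have "- dual_gauge K q y = (1 - s) *\<^sub>R (- dual_gauge K z y) + s *\<^sub>R (- dual_gauge K w y)"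
      unfolding dual_gauge_shift[of z y q] dual_gauge_shift[of w y q]
      by (simp add: q_def inner_simps algebra_simps)
    moreover have "exp ((1 - s) *\<^sub>R (- dual_gauge K z y) + s *\<^sub>R (- dual_gauge K w y))
        \<le> (1 - s) * ?e z y + s * ?e w y"
      using s by (intro convex_onD[OF exp_convex]) auto
    ultimately show ?thesis by simp
  qed
  have "half_polar_integral \<theta> K q
    \<le> (\<integral>\<^sup>+y. ennreal (1 - s) * (ennreal (?e z y) * indicator {y. 0 < y \<bullet> \<theta>} y)
        + ennreal s * (ennreal (?e w y) * indicator {y. 0 < y \<bullet> \<theta>} y) \<partial>lborel)"
    unfolding half_polar_integral_def using s
    by (intro nn_integral_mono)
       (auto split: split_indicator simp: ennreal_mult[symmetric] ennreal_plus[symmetric] le simp del: ennreal_plus)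
  also have "\<dots> = ennreal (1 - s) * half_polar_integral \<theta> K z + ennreal s * half_polar_integral \<theta> K w"
    unfolding half_polar_integral_def by (simp add: nn_integral_add nn_integral_cmult)
  finally have "half_polar_integral \<theta> K q
    \<le> ennreal (1 - s) * half_polar_integral \<theta> K z + ennreal s * half_polar_integral \<theta> K w" .
  moreover obtain a where "half_polar_integral \<theta> K z = ennreal a" "0 \<le> a"
    using half_polar_integral_finite[OF z(1), of \<theta>] by (cases "half_polar_integral \<theta> K z") auto
  moreover obtain b where "half_polar_integral \<theta> K w = ennreal b" "0 \<le> b"
    using half_polar_integral_finite[OF z(2), of \<theta>] by (cases "half_polar_integral \<theta> K w") auto
  moreover obtain c where "half_polar_integral \<theta> K q = ennreal c" "0 \<le> c"
    using half_polar_integral_finite[OF q, of \<theta>] by (cases "half_polar_integral \<theta> K q") auto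
  ultimately show "enn2real (half_polar_integral \<theta> K ((1 - s) *\<^sub>R z + s *\<^sub>R w))
    \<le> (1 - s) * enn2real (half_polar_integral \<theta> K z) + s * enn2real (half_polar_integral \<theta> K w)"
    unfolding q_def[symmetric] using s
    by (simp add: ennreal_mult[symmetric] ennreal_plus[symmetric] del: ennreal_plus)
qed (simp add: convex_interior convex)

lemma half_polar_integral_mono:
  assumes "a \<le> b" shows "half_polar_integral \<theta> K (z + a *\<^sub>R \<theta>) \<le> half_polar_integral \<theta> K (z + b *\<^sub>R \<theta>)"
  unfolding half_polar_integral_def
proof (intro nn_integral_mono)
  fix y
  have "dual_gauge K (z + b *\<^sub>R \<theta>) y = dual_gauge K (z + a *\<^sub>R \<theta>) y + (a - b) * (y \<bullet> \<theta>)"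
    unfolding dual_gauge_shift[of "z + b *\<^sub>R \<theta>" y "z + a *\<^sub>R \<theta>"] by (simp add: inner_simps algebra_simps)
  moreover have "0 < y \<bullet> \<theta> \<Longrightarrow> (a - b) * (y \<bullet> \<theta>) \<le> 0"
    using assms by (simp add: mult_nonpos_nonneg)
  ultimately show "ennreal (exp (- dual_gauge K (z + a *\<^sub>R \<theta>) y)) * indicator {y. 0 < y \<bullet> \<theta>} y
      \<le> ennreal (exp (- dual_gauge K (z + b *\<^sub>R \<theta>) y)) * indicator {y. 0 < y \<bullet> \<theta>} y"
    by (auto split: split_indicator intro!: ennreal_leI)
qed

lemma half_polar_integral_mono_neg:
  "a \<le> b \<Longrightarrow> half_polar_integral (- \<theta>) K (z + b *\<^sub>R \<theta>) \<le> half_polar_integral (- \<theta>) K (z + a *\<^sub>R \<theta>)"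
  using half_polar_integral_mono[of "- b" "- a" "- \<theta>" z] by simp

text \<open>A supporting functional u at the point with parameter b satisfies
  \<open>0 < u \<bullet> \<theta>\<close>, because it is strictly smaller at the interior point with
  parameter a < b. So the half integral in the direction of exit is infinite at b, and
  semicontinuity carries this over to the sequence w.\<close>

lemma half_polar_integral_unbounded:
  assumes a: "z + a *\<^sub>R \<theta> \<in> interior K" and b: "a < b" "z + b *\<^sub>R \<theta> \<notin> interior K"
    and w: "w \<longlonglongrightarrow> b"
  shows "\<forall>\<^sub>F n in sequentially. ennreal r < half_polar_integral \<theta> K (z + w n *\<^sub>R \<theta>)"
proof -
  obtain u where u: "\<And>x. x \<in> K \<Longrightarrow> u \<bullet> x \<le> u \<bullet> (z + b *\<^sub>R \<theta>)"
      "\<And>x. x \<in> interior K \<Longrightarrow> u \<bullet> x < u \<bullet> (z + b *\<^sub>R \<theta>)"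
    by (rule supporting_functional[OF b(2)]) (rule that, assumption+)
  have "a * (u \<bullet> \<theta>) < b * (u \<bullet> \<theta>)" using u(2)[OF a] by (simp add: inner_simps)
  then have "0 < (b - a) * (u \<bullet> \<theta>)" by (simp add: algebra_simps)
  then have "0 < u \<bullet> \<theta>" using b(1) by (simp add: zero_less_mult_iff)
  then have "half_polar_integral \<theta> K (z + b *\<^sub>R \<theta>) = top"
    using u(1) by (intro half_polar_integral_infinite[of u])
  moreover have "(\<lambda>n. z + w n *\<^sub>R \<theta>) \<longlonglongrightarrow> z + b *\<^sub>R \<theta>" by (intro tendsto_intros w)
  ultimately have "top \<le> liminf (\<lambda>n. half_polar_integral \<theta> K (z + w n *\<^sub>R \<theta>))"
    using half_polar_integral_lsc by metis
  then have "ennreal r < liminf (\<lambda>n. half_polar_integral \<theta> K (z + w n *\<^sub>R \<theta>))"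
    by (simp add: top_unique)
  then show ?thesis by (rule less_LiminfD)
qed

end

text \<open>Used with d0 = t - t0 and d1 = t1 - t. As c grows the base points move in opposite
  directions, so \<open>part0 \<theta> c * part1 (- \<theta>) c\<close> is nonincreasing and
  \<open>part0 (- \<theta>) c * part1 \<theta> c\<close> nondecreasing. Changing the signs of both
  \<theta> and c leaves the chords unchanged.\<close>

locale chord_pair = K0: convex_body K0 + K1: convex_body K1
  for K0 K1 :: "'a :: euclidean_space set" +
  fixes \<theta> z :: 'a and d0 d1 c0 :: real
  assumes d: "0 < d0" "0 < d1" and \<theta>: "\<theta> \<noteq> 0"
    and c0: "z - (c0 * d0) *\<^sub>R \<theta> \<in> interior K0" "z + (c0 * d1) *\<^sub>R \<theta> \<in> interior K1"
begin

definition "J = {c. z - (c * d0) *\<^sub>R \<theta> \<in> interior K0 \<and> z + (c * d1) *\<^sub>R \<theta> \<in> interior K1}"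

abbreviation "part0 \<sigma> c \<equiv> enn2real (half_polar_integral \<sigma> K0 (z - (c * d0) *\<^sub>R \<theta>))"
abbreviation "part1 \<sigma> c \<equiv> enn2real (half_polar_integral \<sigma> K1 (z + (c * d1) *\<^sub>R \<theta>))"

lemma J_eq: "J = (\<lambda>c. z - (c * d0) *\<^sub>R \<theta>) -` interior K0 \<inter> (\<lambda>c. z + (c * d1) *\<^sub>R \<theta>) -` interior K1"
  by (auto simp: J_def)

lemma c0_J: "c0 \<in> J" using c0 by (simp add: J_def)

lemma open_J: "open J"
  unfolding J_eq by (intro open_Int open_vimage continuous_intros open_interior)

lemma convex_J: "convex J"
proof (rule convexI)
  fix x y u v :: real assume xy: "x \<in> J" "y \<in> J" and uv: "0 \<le> u" "0 \<le> v" "u + v = 1"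
  have "z - ((u *\<^sub>R x + v *\<^sub>R y) * d0) *\<^sub>R \<theta> = u *\<^sub>R (z - (x * d0) *\<^sub>R \<theta>) + v *\<^sub>R (z - (y * d0) *\<^sub>R \<theta>)"
    "z + ((u *\<^sub>R x + v *\<^sub>R y) * d1) *\<^sub>R \<theta> = u *\<^sub>R (z + (x * d1) *\<^sub>R \<theta>) + v *\<^sub>R (z + (y * d1) *\<^sub>R \<theta>)"
    using uv by (simp_all add: algebra_simps flip: scaleR_add_left)
  then show "u *\<^sub>R x + v *\<^sub>R y \<in> J"
    using xy uv convexD[OF convex_interior[OF K0.convex]] convexD[OF convex_interior[OF K1.convex]]
    by (simp add: J_def)
qed

lemma bounded_J: "bounded J"
proof -
  obtain R where R: "\<And>x. x \<in> K0 \<Longrightarrow> norm x \<le> R"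
    using compact_imp_bounded[OF K0.compact] by (auto simp: bounded_iff)
  have "\<bar>c\<bar> \<le> (R + norm z) / (d0 * norm \<theta>)" if "c \<in> J" for c
  proof -
    have "norm (z - (c * d0) *\<^sub>R \<theta>) \<le> R"
      using that interior_subset by (intro R) (auto simp: J_def)
    moreover have "norm ((c * d0) *\<^sub>R \<theta>) \<le> norm (z - (c * d0) *\<^sub>R \<theta>) + norm z"
      using norm_triangle_ineq4[of z "z - (c * d0) *\<^sub>R \<theta>"] by simp
    ultimately have "\<bar>c\<bar> * (d0 * norm \<theta>) \<le> R + norm z" using d by (simp add: abs_mult)
    then show ?thesis using d \<theta> by (simp add: field_simps)
  qed
  then show ?thesis by (auto simp: bounded_iff)
qed

lemma parts_pos:
  assumes "c \<in> J" "\<sigma> \<noteq> 0" shows "0 < part0 \<sigma> c" "0 < part1 \<sigma> c"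
  using assms K0.half_polar_integral_pos K1.half_polar_integral_pos
    K0.half_polar_integral_finite K1.half_polar_integral_finite
  by (auto simp: enn2real_positive_iff J_def)

text \<open>At b = Sup J a base point is no longer interior: on K0 it moves along -\<theta>, on K1
  along \<theta>, so a factor on the right is unbounded as c approaches b. The other right factor is
  at least its positive value at c0, while the left product is at most its value at c0.\<close>

lemma upper_end: "\<exists>c\<in>J. part0 \<theta> c * part1 (- \<theta>) c \<le> part0 (- \<theta>) c * part1 \<theta> c"
proof -
  define b where "b = Sup J"
  have bdd: "bdd_above J" using bounded_J by (rule bounded_imp_bdd_above)
  have "b \<notin> J"
  proof
    assume "b \<in> J"
    then obtain e where "0 < e" "ball b e \<subseteq> J" using open_J open_contains_ball by blast
    then have "b + e / 2 \<in> J" by (auto simp: subset_iff dist_real_def)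
    then have "b + e / 2 \<le> b" unfolding b_def by (rule cSup_upper[OF _ bdd])
    then show False using \<open>0 < e\<close> by simp
  qed
  moreover have "c0 \<le> b" unfolding b_def by (rule cSup_upper[OF c0_J bdd])
  ultimately have "c0 < b" using c0_J by (cases "c0 = b") auto
  \<comment> \<open>w starts at c0 and increases to b without reaching it, so it stays in the
    interval J.\<close>
  define w where "w n = b - (b - c0) / real (Suc n)" for n
  have w_less: "w n < b" for n using \<open>c0 < b\<close> by (simp add: w_def)
  have w_ge: "c0 \<le> w n" for n
  proof -
    have "(b - c0) / real (Suc n) \<le> (b - c0) / 1"
      using \<open>c0 < b\<close> by (intro divide_left_mono) auto
    then show ?thesis by (simp add: w_def)
  qed
  have w_lim: "w \<longlonglongrightarrow> b"
    unfolding w_def[abs_def] using tendsto_diff[OF tendsto_const lim_inverse_n'[THEN LIMSEQ_Suc, THEN tendsto_mult_left], of b "b - c0"]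
    by simp
  have wJ: "w n \<in> J" for n
  proof -
    obtain c where c: "c \<in> J" "w n < c"
      using less_cSup_iff[OF _ bdd, of "w n"] c0_J w_less[of n] unfolding b_def by blast
    then show ?thesis
      using mem_is_interval_1_I[of J c0 c "w n"] convex_J c0_J w_ge[of n]
      by (simp add: is_interval_convex_1)
  qed
  have mono: "part0 \<theta> c \<le> part0 \<theta> c0" "part0 (- \<theta>) c0 \<le> part0 (- \<theta>) c"
     "part1 \<theta> c0 \<le> part1 \<theta> c" "part1 (- \<theta>) c \<le> part1 (- \<theta>) c0" if "c0 \<le> c" "c \<in> J" for c
  proof -
    have "- (c * d0) \<le> - (c0 * d0)" "c0 * d1 \<le> c * d1" using that d by (auto intro: mult_right_mono)
    note * = K0.half_polar_integral_mono[OF this(1), of \<theta> z] K0.half_polar_integral_mono_neg[OF this(1), of \<theta> z]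
      K1.half_polar_integral_mono[OF this(2), of \<theta> z] K1.half_polar_integral_mono_neg[OF this(2), of \<theta> z]
    show "part0 \<theta> c \<le> part0 \<theta> c0" "part0 (- \<theta>) c0 \<le> part0 (- \<theta>) c"
     "part1 \<theta> c0 \<le> part1 \<theta> c" "part1 (- \<theta>) c \<le> part1 (- \<theta>) c0"
      using * that(2) c0 by (auto intro!: enn2real_mono K0.half_polar_integral_finite K1.half_polar_integral_finite simp: J_def)
  qed
  define R where "R = part0 \<theta> c0 * part1 (- \<theta>) c0"
  have R: "part0 \<theta> (w n) * part1 (- \<theta>) (w n) \<le> R" for n
    unfolding R_def using mono[OF w_ge wJ] by (intro mult_mono) auto
  have pos: "0 < part0 (- \<theta>) c0" "0 < part1 \<theta> c0" using parts_pos[OF c0_J] \<theta> by auto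
  consider "z - (b * d0) *\<^sub>R \<theta> \<notin> interior K0" | "z + (b * d1) *\<^sub>R \<theta> \<notin> interior K1"
    using \<open>b \<notin> J\<close> by (auto simp: J_def)
  then obtain n where "R \<le> part0 (- \<theta>) (w n) * part1 \<theta> (w n)"
  proof cases
    case 1
    \<comment> \<open>The chord of K0 is read in the direction -\<theta> with parameter c * d0, the
      shape that \<open>half_polar_integral_unbounded\<close> expects.\<close>
    have "\<forall>\<^sub>F n in sequentially. ennreal (R / part1 \<theta> c0) < half_polar_integral (- \<theta>) K0 (z + (w n * d0) *\<^sub>R (- \<theta>))"
      using 1 c0 \<open>c0 < b\<close> d w_lim
      by (intro K0.half_polar_integral_unbounded[of z "c0 * d0" "- \<theta>" "b * d0"]) (auto intro: tendsto_mult_right)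
    then obtain n where "ennreal (R / part1 \<theta> c0) < half_polar_integral (- \<theta>) K0 (z + (w n * d0) *\<^sub>R (- \<theta>))"
      using eventually_happens'[OF sequentially_bot] by blast
    then have "R / part1 \<theta> c0 \<le> part0 (- \<theta>) (w n)"
      using K0.half_polar_integral_finite[of "z - (w n * d0) *\<^sub>R \<theta>" "- \<theta>"] wJ[of n]
      by (cases "half_polar_integral (- \<theta>) K0 (z - (w n * d0) *\<^sub>R \<theta>)") (auto simp: J_def ennreal_less_iff R_def)
    then have "R \<le> part0 (- \<theta>) (w n) * part1 \<theta> c0" using pos by (simp add: field_simps)
    also have "\<dots> \<le> part0 (- \<theta>) (w n) * part1 \<theta> (w n)"
      using mono[OF w_ge wJ] by (intro mult_left_mono) auto
    finally show ?thesis by (rule that)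
  next
    case 2
    have "\<forall>\<^sub>F n in sequentially. ennreal (R / part0 (- \<theta>) c0) < half_polar_integral \<theta> K1 (z + (w n * d1) *\<^sub>R \<theta>)"
      using 2 c0 \<open>c0 < b\<close> d w_lim
      by (intro K1.half_polar_integral_unbounded[of z "c0 * d1" \<theta> "b * d1"]) (auto intro: tendsto_mult_right)
    then obtain n where "ennreal (R / part0 (- \<theta>) c0) < half_polar_integral \<theta> K1 (z + (w n * d1) *\<^sub>R \<theta>)"
      using eventually_happens'[OF sequentially_bot] by blast
    then have "R / part0 (- \<theta>) c0 \<le> part1 \<theta> (w n)"
      using K1.half_polar_integral_finite[of "z + (w n * d1) *\<^sub>R \<theta>" \<theta>] wJ[of n]
      by (cases "half_polar_integral \<theta> K1 (z + (w n * d1) *\<^sub>R \<theta>)") (auto simp: J_def ennreal_less_iff R_def)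
    then have "R \<le> part0 (- \<theta>) c0 * part1 \<theta> (w n)" using pos by (simp add: field_simps)
    also have "\<dots> \<le> part0 (- \<theta>) (w n) * part1 \<theta> (w n)"
      using mono[OF w_ge wJ] by (intro mult_right_mono) auto
    finally show ?thesis by (rule that)
  qed
  then show ?thesis using R[of n] wJ[of n] by (meson order_trans)
qed

lemma balanced_point:
  "\<exists>c\<in>J. part0 \<theta> c * part1 (- \<theta>) c = part0 (- \<theta>) c * part1 \<theta> c"
proof -
  interpret neg: chord_pair K0 K1 "- \<theta>" z d0 d1 "- c0"
    using c0 d \<theta> by unfold_locales auto
  define \<phi> where "\<phi> c = part0 \<theta> c * part1 (- \<theta>) c - part0 (- \<theta>) c * part1 \<theta> c" for c
  obtain x where x: "x \<in> J" "\<phi> x \<le> 0" using upper_end by (auto simp: \<phi>_def)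
  obtain y where y: "- y \<in> J" "0 \<le> \<phi> (- y)"
    using neg.upper_end by (auto simp: \<phi>_def J_def neg.J_def)
  have cont: "continuous_on J \<phi>"
    unfolding \<phi>_def
    by (intro continuous_intros continuous_on_compose2[OF K0.continuous_half_polar_integral]
        continuous_on_compose2[OF K1.continuous_half_polar_integral]) (auto simp: J_def)
  have "connected (\<phi> ` J)"
    using convex_connected[OF convex_J] cont by (rule connected_continuous_image[rotated])
  then have "0 \<in> \<phi> ` J"
    using x y by (meson connected_contains_Icc atLeastAtMost_iff imageI subsetD)
  then show ?thesis by (auto simp: \<phi>_def)
qed

end

section \<open>Shadow systems\<close>

text \<open>\<open>mean_le\<close> tests only reals strictly below f and g; the test values f s and
  g s with s < 1 give s times the harmonic mean, and s tends to 1.\<close>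

lemma mean_le_one_real:
  assumes "mean_le 1 l (ennreal f) (ennreal g) (ennreal h)" and l: "0 < l" "l < 1" and pos: "0 < f" "0 < g" "0 \<le> h"
  shows "1 / ((1 - l) / f + l / g) \<le> h"
proof (rule field_le_mult_one_interval)
  fix s :: real assume s: "0 < s" "s < 1"
  have "ennreal (hmean 1 l (f * s) (g * s)) \<le> ennreal h"
    using s pos by (intro mean_leD[OF assms(1)]) (auto simp: ennreal_less_iff)
  then have "hmean 1 l (f * s) (g * s) \<le> h" using pos by simp
  moreover have "hmean 1 l (f * s) (g * s) = s * (1 / ((1 - l) / f + l / g))"
    using hmean_scale[of 1 l f g s] hmean_one[of f g l] l pos s by simp
  ultimately show "s * (1 / ((1 - l) / f + l / g)) \<le> h" by simp
qed

text \<open>With A0 = k A1 and B0 = k B1 the harmonic means are A1 / q and B1 / q for the same q, so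
  they add up to the harmonic mean of the sums.\<close>

lemma proportional_harmonic_sum:
  fixes A0 A1 B0 B1 A B l :: real
  assumes pos: "0 < A0" "0 < A1" "0 < B0" "0 < B1" "0 < l" "l < 1"
    and ratio: "A0 * B1 = B0 * A1"
    and A: "1 / ((1 - l) / A0 + l / A1) \<le> A" and B: "1 / ((1 - l) / B0 + l / B1) \<le> B"
  shows "1 / (A + B) \<le> (1 - l) / (A0 + B0) + l / (A1 + B1)"
proof -
  define k where "k = A0 / A1"
  have k: "0 < k" "A0 = k * A1" "B0 = k * B1"
    using pos ratio by (auto simp: k_def field_simps)
  define q where "q = (1 - l) / k + l"
  have q: "0 < q" using pos k(1) by (auto simp: q_def intro!: add_nonneg_pos)
  have *: "(1 - l) / (k * x) + l / x = q / x" for x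
    by (simp add: q_def add_divide_distrib)
  have "(A1 + B1) / q \<le> A + B"
    using A B unfolding k * by (simp add: add_divide_distrib)
  then have "1 / (A + B) \<le> 1 / ((A1 + B1) / q)"
    using pos q by (intro divide_left_mono mult_pos_pos) (auto intro: order_less_le_trans[rotated])
  also have "\<dots> = (1 - l) / (A0 + B0) + l / (A1 + B1)"
    using *[of "A1 + B1"] by (simp add: k(2,3) distrib_left)
  finally show ?thesis .
qed

definition shadow :: "'a :: euclidean_space set \<Rightarrow> ('a \<Rightarrow> real) \<Rightarrow> 'a \<Rightarrow> real \<Rightarrow> 'a set" where
  "shadow M \<alpha> \<theta> t = closure (convex hull ((\<lambda>x. x + (\<alpha> x * t) *\<^sub>R \<theta>) ` M))"

lemma shadow_memI: "x \<in> M \<Longrightarrow> x + (\<alpha> x * t) *\<^sub>R \<theta> \<in> shadow M \<alpha> \<theta> t"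
  unfolding shadow_def by (intro subsetD[OF closure_subset] hull_inc imageI)

lemma convex_body_shadow:
  assumes M: "bounded M" "bounded (\<alpha> ` M)" and int: "interior (shadow M \<alpha> \<theta> t) \<noteq> {}"
  shows "convex_body (shadow M \<alpha> \<theta> t)"
proof
  obtain R where R: "\<And>x. x \<in> M \<Longrightarrow> norm x \<le> R" using M(1) by (auto simp: bounded_iff)
  obtain S where S: "\<And>x. x \<in> M \<Longrightarrow> \<bar>\<alpha> x\<bar> \<le> S" using M(2) by (auto simp: bounded_iff)
  have "norm (x + (\<alpha> x * t) *\<^sub>R \<theta>) \<le> R + S * \<bar>t\<bar> * norm \<theta>" if "x \<in> M" for x
  proof -
    have "\<bar>\<alpha> x\<bar> * \<bar>t\<bar> * norm \<theta> \<le> S * \<bar>t\<bar> * norm \<theta>"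
      using S[OF that] by (intro mult_right_mono) auto
    then show ?thesis
      using R[OF that] norm_triangle_ineq[of x "(\<alpha> x * t) *\<^sub>R \<theta>"] by (simp add: abs_mult)
  qed
  then have "bounded ((\<lambda>x. x + (\<alpha> x * t) *\<^sub>R \<theta>) ` M)" by (auto simp: bounded_iff)
  then show "compact (shadow M \<alpha> \<theta> t)"
    unfolding shadow_def by (simp add: compact_closure bounded_convex_hull)
  show "convex (shadow M \<alpha> \<theta> t)"
    unfolding shadow_def by (intro convex_closure convex_convex_hull)
qed (rule int)

section \<open>A shadow system at three parameter values\<close>

locale shadow_triple =
  fixes M :: "'a :: euclidean_space set" and \<alpha> :: "'a \<Rightarrow> real" and \<theta> :: 'a and t0 t1 l t :: real
  assumes M: "bounded M" "bounded (\<alpha> ` M)" and \<theta>: "\<theta> \<noteq> 0" and l: "0 < l" "l < 1"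
    and t01: "t0 < t1" and t: "t = (1 - l) * t0 + l * t1"
    and body: "convex_body (shadow M \<alpha> \<theta> t0)" "convex_body (shadow M \<alpha> \<theta> t1)" "convex_body (shadow M \<alpha> \<theta> t)"
begin

sublocale K0: convex_body "shadow M \<alpha> \<theta> t0" by (rule body)
sublocale K1: convex_body "shadow M \<alpha> \<theta> t1" by (rule body)
sublocale Kt: convex_body "shadow M \<alpha> \<theta> t" by (rule body)

text \<open>A closed half space contains the shadow as soon as it contains the generators.\<close>

lemma dual_gauge_shadow_le:
  assumes "convex_body (shadow M \<alpha> \<theta> s)" "\<And>x. x \<in> M \<Longrightarrow> y \<bullet> (x + (\<alpha> x * s) *\<^sub>R \<theta> - z) \<le> c"
  shows "dual_gauge (shadow M \<alpha> \<theta> s) z y \<le> c"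
proof (rule convex_body.dual_gauge_le[OF assms(1)])
  have "y \<bullet> (x + (\<alpha> x * s) *\<^sub>R \<theta>) \<le> c + y \<bullet> z" if "x \<in> M" for x
    using assms(2)[OF that] unfolding inner_diff_right by linarith
  then have "shadow M \<alpha> \<theta> s \<subseteq> {x. y \<bullet> x \<le> c + y \<bullet> z}"
    unfolding shadow_def
    by (intro closure_minimal hull_minimal closed_halfspace_le convex_halfspace_le) auto
  then show "y \<bullet> (x - z) \<le> c" if "x \<in> shadow M \<alpha> \<theta> s" for x
    using that by (auto simp: inner_diff_right)
qed

lemma M_nonempty: "M \<noteq> {}"
  using K0.nonempty by (auto simp: shadow_def)

text \<open>The line \<open>c \<mapsto> (z + c (t0 - t) \<theta>, z + c (t1 - t) \<theta>)\<close> meets \<open>int K0 \<times> int K1\<close>: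
  a hyperplane separating the two would contradict that \<open>z\<close> is interior to the intermediate body.\<close>

lemma interior_chords:
  assumes z: "z \<in> interior (shadow M \<alpha> \<theta> t)"
  obtains c where "z + (c * (t0 - t)) *\<^sub>R \<theta> \<in> interior (shadow M \<alpha> \<theta> t0)"
    "z + (c * (t1 - t)) *\<^sub>R \<theta> \<in> interior (shadow M \<alpha> \<theta> t1)"
proof (rule ccontr)
  note chord = that
  assume "\<not> thesis"
  define A where "A = interior (shadow M \<alpha> \<theta> t0) \<times> interior (shadow M \<alpha> \<theta> t1)"
  define B where "B = range (\<lambda>c. (z, z) + c *\<^sub>R ((t0 - t) *\<^sub>R \<theta>, (t1 - t) *\<^sub>R \<theta>))"
  have "convex A" unfolding A_def
    by (intro convex_Times convex_interior K0.convex K1.convex)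
  moreover have "convex B"
  proof -
    have "B = (+) (z, z) ` range (\<lambda>c. c *\<^sub>R ((t0 - t) *\<^sub>R \<theta>, (t1 - t) *\<^sub>R \<theta>))"
      by (auto simp: B_def image_image)
    moreover have "linear (\<lambda>c::real. c *\<^sub>R ((t0 - t) *\<^sub>R \<theta>, (t1 - t) *\<^sub>R \<theta>))"
      by (rule linear_scaleR_left)
    ultimately show ?thesis
      by (simp add: convex_translation convex_linear_image)
  qed
  moreover have "A \<noteq> {}" "B \<noteq> {}" using K0.interior K1.interior by (auto simp: A_def B_def)
  moreover have "A \<inter> B = {}" using \<open>\<not> thesis\<close> chord by (auto simp: A_def B_def)
  ultimately obtain u b where u: "u \<noteq> 0" "\<And>x. x \<in> A \<Longrightarrow> u \<bullet> x \<le> b" "\<And>x. x \<in> B \<Longrightarrow> b \<le> u \<bullet> x"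
    using separating_hyperplane_sets[of A B] by metis
  obtain u0 u1 where u01: "u = (u0, u1)" by (cases u)
  \<comment> \<open>D is the slope of u along the line B. An affine function bounded below on a
    whole line is constant, hence D = 0.\<close>
  define D where "D = (t0 - t) * (u0 \<bullet> \<theta>) + (t1 - t) * (u1 \<bullet> \<theta>)"
  have line: "b \<le> (u0 + u1) \<bullet> z + c * D" for c
  proof -
    have "b \<le> u \<bullet> ((z, z) + c *\<^sub>R ((t0 - t) *\<^sub>R \<theta>, (t1 - t) *\<^sub>R \<theta>))"
      by (rule u(3)) (unfold B_def, rule rangeI)
    then show ?thesis by (simp add: u01 D_def inner_add_left inner_add_right distrib_left)
  qed
  have "D = 0"
  proof (rule ccontr)
    assume "D \<noteq> 0"
    then show False using line[of "(b - (u0 + u1) \<bullet> z - 1) / D"] by simp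
  qed
  have sep: "u0 \<bullet> x + u1 \<bullet> y \<le> b" if "x \<in> shadow M \<alpha> \<theta> t0" "y \<in> shadow M \<alpha> \<theta> t1" for x y
  proof -
    have "closure A \<subseteq> {x. u \<bullet> x \<le> b}"
      using u(2) by (intro closure_minimal closed_halfspace_le) auto
    moreover have "(x, y) \<in> closure A"
      using that closure_subset convex_closure_interior[OF K0.convex K0.interior]
        convex_closure_interior[OF K1.convex K1.interior]
      by (auto simp: A_def closure_Times)
    ultimately show ?thesis by (auto simp: u01)
  qed
  \<comment> \<open>With D = 0, the value of u at the pair of generators for t0 and t1 equals that
    of \<open>u0 + u1\<close> at the generator for t. A nonzero \<open>u0 + u1\<close> would thus
    support the shadow at its interior point z.\<close>
  have "dual_gauge (shadow M \<alpha> \<theta> t) z (u0 + u1) \<le> 0"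
  proof (rule dual_gauge_shadow_le[OF body(3)])
    fix x assume x: "x \<in> M"
    have "u0 \<bullet> (x + (\<alpha> x * t0) *\<^sub>R \<theta>) + u1 \<bullet> (x + (\<alpha> x * t1) *\<^sub>R \<theta>)
      = (u0 + u1) \<bullet> (x + (\<alpha> x * t) *\<^sub>R \<theta>) + \<alpha> x * D"
      by (simp add: D_def inner_add_left inner_add_right algebra_simps)
    then have "(u0 + u1) \<bullet> (x + (\<alpha> x * t) *\<^sub>R \<theta>) \<le> b"
      using sep[OF shadow_memI[OF x] shadow_memI[OF x]] \<open>D = 0\<close> by simp
    then show "(u0 + u1) \<bullet> (x + (\<alpha> x * t) *\<^sub>R \<theta> - z) \<le> 0"
      using line[of 0] unfolding inner_diff_right by linarith
  qed
  then have "u0 + u1 = 0" using Kt.dual_gauge_pos[OF z, of "u0 + u1"] by force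
  then have u1: "u1 = - u0" by (simp add: add_eq_0_iff)
  then have "u0 \<noteq> 0" using u(1) u01 by (auto simp: zero_prod_def)
  have "u0 \<bullet> \<theta> = 0" using \<open>D = 0\<close> t01 by (simp add: D_def u1 algebra_simps)
  \<comment> \<open>What remains is u1 = -u0 with u0 orthogonal to \<theta>. Comparing the
    generators of arbitrary x and y makes u0 constant on M, hence on the shadow at t0, which would
    then lie in a hyperplane.\<close>
  have "u0 \<bullet> x \<le> u0 \<bullet> y" if "x \<in> M" "y \<in> M" for x y
    using sep[OF shadow_memI[OF that(1)] shadow_memI[OF that(2)]] line[of 0] \<open>u0 \<bullet> \<theta> = 0\<close>
    by (simp add: u1 inner_add_right)
  then have const: "u0 \<bullet> x = u0 \<bullet> y" if "x \<in> M" "y \<in> M" for x y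
    using that by (blast intro: antisym)
  obtain y where y: "y \<in> M" using M_nonempty by blast
  obtain q where q: "q \<in> interior (shadow M \<alpha> \<theta> t0)" using K0.interior by blast
  have "dual_gauge (shadow M \<alpha> \<theta> t0) q u0 \<le> u0 \<bullet> y - u0 \<bullet> q"
    using const[OF _ y] \<open>u0 \<bullet> \<theta> = 0\<close>
    by (intro dual_gauge_shadow_le[OF body(1)]) (simp add: inner_diff_right inner_add_right)
  moreover have "dual_gauge (shadow M \<alpha> \<theta> t0) q (- u0) \<le> u0 \<bullet> q - u0 \<bullet> y"
    using const[OF _ y] \<open>u0 \<bullet> \<theta> = 0\<close>
    by (intro dual_gauge_shadow_le[OF body(1)]) (simp add: inner_diff_right inner_add_right)
  ultimately show False
    using K0.dual_gauge_pos[OF q, of u0] K0.dual_gauge_pos[OF q, of "- u0"] \<open>u0 \<noteq> 0\<close> by simp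
qed

text \<open>On the slice \<open>y \<bullet> \<sigma> = 1\<close> the value
  \<open>y \<bullet> \<theta>\<close> is the constant 1 or -1. So the pairing with each generator is
  affine under the combination of (x, t0) and (y, t1), and the displacements c (t0 - t) and c (t1 -
  t) average to 0. Bounding each generator gives the convexity for
  \<open>mean_le_half_space\<close>.\<close>

lemma half_polar_harmonic:
  assumes "z0 = z + (c * (t0 - t)) *\<^sub>R \<theta>" "z1 = z + (c * (t1 - t)) *\<^sub>R \<theta>"
    and int: "z0 \<in> interior (shadow M \<alpha> \<theta> t0)" "z1 \<in> interior (shadow M \<alpha> \<theta> t1)" "z \<in> interior (shadow M \<alpha> \<theta> t)"
    and \<sigma>: "\<sigma> = \<theta> \<or> \<sigma> = - \<theta>"
  shows "1 / ((1 - l) / enn2real (half_polar_integral \<sigma> (shadow M \<alpha> \<theta> t0) z0)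
      + l / enn2real (half_polar_integral \<sigma> (shadow M \<alpha> \<theta> t1) z1))
    \<le> enn2real (half_polar_integral \<sigma> (shadow M \<alpha> \<theta> t) z)"
proof (rule mean_le_one_real[OF _ l])
  have "\<sigma> \<noteq> 0" using \<sigma> \<theta> by auto
  have nz: "y \<noteq> 0" if "0 < y \<bullet> \<sigma>" for y using that by auto
  have "mean_le 1 l (half_polar_integral \<sigma> (shadow M \<alpha> \<theta> t0) z0)
     (half_polar_integral \<sigma> (shadow M \<alpha> \<theta> t1) z1) (half_polar_integral \<sigma> (shadow M \<alpha> \<theta> t) z)"
    unfolding half_polar_integral_def
  proof (rule mean_le_half_space[OF \<open>\<sigma> \<noteq> 0\<close> l])
    fix x y assume xy: "x \<bullet> \<sigma> = 1" "y \<bullet> \<sigma> = 1"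
    then have e: "x \<bullet> \<theta> = y \<bullet> \<theta>" using \<sigma> by auto
    show "dual_gauge (shadow M \<alpha> \<theta> t) z ((1 - l) *\<^sub>R x + l *\<^sub>R y)
      \<le> (1 - l) * dual_gauge (shadow M \<alpha> \<theta> t0) z0 x + l * dual_gauge (shadow M \<alpha> \<theta> t1) z1 y"
    proof (rule dual_gauge_shadow_le[OF body(3)])
      fix m assume m: "m \<in> M"
      have "((1 - l) *\<^sub>R x + l *\<^sub>R y) \<bullet> (m + (\<alpha> m * t) *\<^sub>R \<theta> - z)
        = (1 - l) * (x \<bullet> (m + (\<alpha> m * t0) *\<^sub>R \<theta> - z0)) + l * (y \<bullet> (m + (\<alpha> m * t1) *\<^sub>R \<theta> - z1))"
        unfolding assms(1,2) t by (simp add: inner_simps e algebra_simps)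
      also have "\<dots> \<le> (1 - l) * dual_gauge (shadow M \<alpha> \<theta> t0) z0 x + l * dual_gauge (shadow M \<alpha> \<theta> t1) z1 y"
        using l m by (intro add_mono mult_left_mono K0.dual_gauge_ge K1.dual_gauge_ge shadow_memI) auto
      finally show "((1 - l) *\<^sub>R x + l *\<^sub>R y) \<bullet> (m + (\<alpha> m * t) *\<^sub>R \<theta> - z)
        \<le> (1 - l) * dual_gauge (shadow M \<alpha> \<theta> t0) z0 x + l * dual_gauge (shadow M \<alpha> \<theta> t1) z1 y" .
    qed
  qed (simp_all add: K0.dual_gauge_scale K1.dual_gauge_scale Kt.dual_gauge_scale
      K0.dual_gauge_pos K1.dual_gauge_pos Kt.dual_gauge_pos int nz)
  then show "mean_le 1 l (ennreal (enn2real (half_polar_integral \<sigma> (shadow M \<alpha> \<theta> t0) z0)))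
     (ennreal (enn2real (half_polar_integral \<sigma> (shadow M \<alpha> \<theta> t1) z1)))
     (ennreal (enn2real (half_polar_integral \<sigma> (shadow M \<alpha> \<theta> t) z)))"
    using K0.half_polar_integral_finite[OF int(1)] K1.half_polar_integral_finite[OF int(2)]
      Kt.half_polar_integral_finite[OF int(3)] by simp
  show "0 < enn2real (half_polar_integral \<sigma> (shadow M \<alpha> \<theta> t0) z0)"
    "0 < enn2real (half_polar_integral \<sigma> (shadow M \<alpha> \<theta> t1) z1)"
    using K0.half_polar_integral_finite[OF int(1)] K1.half_polar_integral_finite[OF int(2)]
      K0.half_polar_integral_pos K1.half_polar_integral_pos \<open>\<sigma> \<noteq> 0\<close>
    by (auto simp: enn2real_positive_iff)
qed simp

lemma polar_integral_harmonic:
  assumes z: "z \<in> interior (shadow M \<alpha> \<theta> t)"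
  obtains z0 z1 where "z0 \<in> interior (shadow M \<alpha> \<theta> t0)" "z1 \<in> interior (shadow M \<alpha> \<theta> t1)"
    "1 / enn2real (polar_integral (shadow M \<alpha> \<theta> t) z)
      \<le> (1 - l) / enn2real (polar_integral (shadow M \<alpha> \<theta> t0) z0)
        + l / enn2real (polar_integral (shadow M \<alpha> \<theta> t1) z1)"
proof -
  have d: "t - t0 = l * (t1 - t0)" "t1 - t = (1 - l) * (t1 - t0)" by (simp_all add: t algebra_simps)
  obtain c0 where c0: "z + (c0 * (t0 - t)) *\<^sub>R \<theta> \<in> interior (shadow M \<alpha> \<theta> t0)"
    "z + (c0 * (t1 - t)) *\<^sub>R \<theta> \<in> interior (shadow M \<alpha> \<theta> t1)"
    by (rule interior_chords[OF z])
  have minus: "z - (c * (t - t0)) *\<^sub>R \<theta> = z + (c * (t0 - t)) *\<^sub>R \<theta>" for c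
    by (simp add: algebra_simps)
  interpret pair: chord_pair "shadow M \<alpha> \<theta> t0" "shadow M \<alpha> \<theta> t1" \<theta> z "t - t0" "t1 - t" c0
    using c0 l t01 \<theta> by unfold_locales (simp_all only: minus, simp_all add: d)
  obtain c where c: "c \<in> pair.J" and bal: "pair.part0 \<theta> c * pair.part1 (- \<theta>) c = pair.part0 (- \<theta>) c * pair.part1 \<theta> c"
    using pair.balanced_point by blast
  define z0 where "z0 = z + (c * (t0 - t)) *\<^sub>R \<theta>"
  define z1 where "z1 = z + (c * (t1 - t)) *\<^sub>R \<theta>"
  have int: "z0 \<in> interior (shadow M \<alpha> \<theta> t0)" "z1 \<in> interior (shadow M \<alpha> \<theta> t1)"
    using c by (simp_all add: pair.J_def minus z0_def z1_def)
  have split: "enn2real (polar_integral K w) = enn2real (half_polar_integral \<theta> K w) + enn2real (half_polar_integral (- \<theta>) K w)"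
    if "convex_body K" "w \<in> interior K" for K w
    using convex_body.polar_integral_split[OF that(1) \<theta>, of w] convex_body.half_polar_integral_finite[OF that]
    by (simp add: enn2real_plus)
  have "- \<theta> \<noteq> 0" using \<theta> by simp
  note pos = pair.parts_pos[OF c \<theta>, unfolded minus, folded z0_def z1_def]
    pair.parts_pos[OF c \<open>- \<theta> \<noteq> 0\<close>, unfolded minus, folded z0_def z1_def]
  show ?thesis
  proof (rule that[OF int])
    show "1 / enn2real (polar_integral (shadow M \<alpha> \<theta> t) z)
      \<le> (1 - l) / enn2real (polar_integral (shadow M \<alpha> \<theta> t0) z0)
        + l / enn2real (polar_integral (shadow M \<alpha> \<theta> t1) z1)"
      unfolding split[OF body(1) int(1)] split[OF body(2) int(2)] split[OF body(3) z]
      using pos bal[unfolded minus, folded z0_def z1_def] l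
      by (intro proportional_harmonic_sum half_polar_harmonic[OF z0_def z1_def int z]) simp_all
  qed
qed

end

theorem theorem1:
  fixes K :: "real \<Rightarrow> (real ^ 'n) set" and \<theta> :: "real ^ 'n" and a b :: real
  assumes "nondegenerate_shadow_system {a..b} \<theta> K"
  shows "convex_on {a..b} (\<lambda>t. inverse (measure lebesgue (santalo_polar (K t))))"
proof -
  obtain M \<alpha> where \<theta>: "\<theta> \<in> sphere 0 1" and M: "bounded M" "bounded (\<alpha> ` M)"
    and K: "\<And>t. t \<in> {a..b} \<Longrightarrow> K t = shadow M \<alpha> \<theta> t" and int: "\<And>t. t \<in> {a..b} \<Longrightarrow> interior (K t) \<noteq> {}"
    using assms unfolding nondegenerate_shadow_system_def shadow_system_def shadow_def[symmetric] by blast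
  have \<theta>0: "\<theta> \<noteq> 0" using \<theta> by auto
  have body: "convex_body (shadow M \<alpha> \<theta> t)" if "t \<in> {a..b}" for t
    using convex_body_shadow[OF M] int[OF that] K[OF that] by simp
  define P where "P t = enn2real (polar_integral (shadow M \<alpha> \<theta> t) (santalo_point (shadow M \<alpha> \<theta> t)))" for t
  have vol: "inverse (measure lebesgue (santalo_polar (K t))) = fact CARD('n) * (1 / P t)" if "t \<in> {a..b}" for t
    using santalo(3)[OF body[OF that]] K[OF that] by (simp add: P_def)
  have min: "0 < P t" "P t \<le> enn2real (polar_integral (shadow M \<alpha> \<theta> t) z)"
    if "t \<in> {a..b}" "z \<in> interior (shadow M \<alpha> \<theta> t)" for t z
  proof -
    interpret convex_body "shadow M \<alpha> \<theta> t" using that(1) by (rule body)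
    note s = santalo[OF body[OF that(1)]]
    have "0 < polar_integral (shadow M \<alpha> \<theta> t) (santalo_point (shadow M \<alpha> \<theta> t))"
      unfolding polar_integral_split[OF \<theta>0]
      by (intro add_pos_nonneg half_polar_integral_pos \<theta>0) simp
    then show "0 < P t"
      using polar_integral_finite[OF s(1)] by (simp add: P_def enn2real_positive_iff)
    show "P t \<le> enn2real (polar_integral (shadow M \<alpha> \<theta> t) z)"
      unfolding P_def polar_integral_le_iff[OF s(1) that(2)] by (rule s(2)[OF that(2)])
  qed
  show ?thesis
  \<comment> \<open>Restricting to x < y supplies \<open>t0 < t1\<close> in
    \<open>shadow_triple\<close>, which makes both chord speeds d0 and d1 positive.\<close>
  proof (rule convex_on_linorderI)
    fix l x y :: real assume l: "0 < l" "l < 1" and xy: "x \<in> {a..b}" "y \<in> {a..b}" "x < y"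
    define t where "t = (1 - l) * x + l * y"
    have t_ab: "t \<in> {a..b}"
      using convexD_alt[OF convex_real_interval(5)[of a b] xy(1,2), of l] l by (simp add: t_def)
    interpret shadow_triple M \<alpha> \<theta> x y l t
      by unfold_locales (use M \<theta>0 l xy body t_ab in \<open>auto simp: t_def convex_body_def\<close>)
    obtain z0 z1 where z: "z0 \<in> interior (shadow M \<alpha> \<theta> x)" "z1 \<in> interior (shadow M \<alpha> \<theta> y)"
      and le: "1 / P t \<le> (1 - l) / enn2real (polar_integral (shadow M \<alpha> \<theta> x) z0)
        + l / enn2real (polar_integral (shadow M \<alpha> \<theta> y) z1)"
      unfolding P_def by (rule polar_integral_harmonic[OF santalo(1)[OF body(3)]])
    have "(1 - l) / enn2real (polar_integral (shadow M \<alpha> \<theta> x) z0) \<le> (1 - l) / P x"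
      "l / enn2real (polar_integral (shadow M \<alpha> \<theta> y) z1) \<le> l / P y"
      using min[OF xy(1) z(1)] min[OF xy(2) z(2)] l by (auto intro!: divide_left_mono)
    with le have "1 / P t \<le> (1 - l) / P x + l / P y" by linarith
    then have "fact CARD('n) * (1 / P t) \<le> fact CARD('n) * ((1 - l) / P x + l / P y)"
      by (rule mult_left_mono) simp
    moreover have "(1 - l) *\<^sub>R x + l *\<^sub>R y = t" by (simp add: t_def)
    ultimately show "inverse (measure lebesgue (santalo_polar (K ((1 - l) *\<^sub>R x + l *\<^sub>R y))))
      \<le> (1 - l) * inverse (measure lebesgue (santalo_polar (K x)))
        + l * inverse (measure lebesgue (santalo_polar (K y)))"
      using vol[OF xy(1)] vol[OF xy(2)] vol[OF t_ab] by (simp add: algebra_simps)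
  qed simp
qed

end
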